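(* Let $\Omega\subset\mathbb{R}^2$ be a convex body (compact convex set with non-empty interior) with piecewise $C^1$ boundary which is axially symmetric, i.e. invariant under the reflection in some line. Then for every $\alpha$ with $1<\alpha<3$, $\Omega$ has a unique $r^{\alpha-2}$-center.
   Context: For $\alpha>0$ and $x\in\mathbb{R}^2$, with $r=|y-x|$: $V_\Omega^{(\alpha)}(x)=\int_\Omega r^{\alpha-2}\,dy$ if $\alpha\ne 2$, and $V_\Omega^{(2)}(x)=-\int_\Omega\log r\,dy$. A point $x\in\mathbb{R}^2$ is an $r^{\alpha-2}$-center of $\Omega$ if it attains the maximum of $V_\Omega^{(\alpha)}$ over $\mathbb{R}^2$ when $0<\alpha\le 2$, or the minimum of $V_\Omega^{(\alpha)}$ over $\mathbb{R}^2$ when $\alpha>2$. *)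

theory Defs
  imports "HOL-Analysis.Analysis"
begin

definition riesz_potential :: "real \<Rightarrow> (real^2) set \<Rightarrow> real^2 \<Rightarrow> real" where
  "riesz_potential \<alpha> \<Omega> x =
     (if \<alpha> = 2 then - (\<integral>y\<in>\<Omega>. ln (dist y x) \<partial>lborel)
      else (\<integral>y\<in>\<Omega>. (dist y x) powr (\<alpha> - 2) \<partial>lborel))"

definition is_riesz_center :: "real \<Rightarrow> (real^2) set \<Rightarrow> real^2 \<Rightarrow> bool" where
  "is_riesz_center \<alpha> \<Omega> x \<longleftrightarrow>
     (if \<alpha> \<le> 2 then (\<forall>z. riesz_potential \<alpha> \<Omega> z \<le> riesz_potential \<alpha> \<Omega> x)
      else (\<forall>z. riesz_potential \<alpha> \<Omega> x \<le> riesz_potential \<alpha> \<Omega> z))"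

definition convex_body :: "(real^2) set \<Rightarrow> bool" where
  "convex_body \<Omega> \<longleftrightarrow> compact \<Omega> \<and> convex \<Omega> \<and> interior \<Omega> \<noteq> {}"

definition piecewise_C1_boundary :: "(real^2) set \<Rightarrow> bool" where
  "piecewise_C1_boundary \<Omega> \<longleftrightarrow>
     (\<exists>g :: real \<Rightarrow> real^2. simple_path g \<and> pathfinish g = pathstart g \<and>
        g piecewise_C1_differentiable_on {0..1} \<and> path_image g = frontier \<Omega>)"

text \<open>Reflection in the line through p with unit normal u.\<close>
definition line_reflection :: "real^2 \<Rightarrow> real^2 \<Rightarrow> real^2 \<Rightarrow> real^2" where
  "line_reflection p u x = x - (2 * ((x - p) \<bullet> u)) *\<^sub>R u"

definition axially_symmetric :: "(real^2) set \<Rightarrow> bool" where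
  "axially_symmetric \<Omega> \<longleftrightarrow>
     (\<exists>p u. norm u = 1 \<and> line_reflection p u ` \<Omega> = \<Omega>)"

end

theory Submission
  imports Defs
begin

text \<open>
  Up to a factor whose sign depends on \<open>\<alpha>\<close>, the potential is the integral \<open>W\<close> of a decreasing kernel,
  so centers are maximum points of \<open>W\<close>. Its derivative in a unit direction \<open>e\<close> is the mass of
  \<open>\<bar>z \<bullet> e\<bar> \<bar>z\<bar> powr (\<alpha> - 4)\<close> on the part of \<open>\<Omega> - x\<close> ahead of \<open>x\<close>, minus the mass on the part behind.

  Perpendicular to the axis, reflecting the outer part of \<open>\<Omega> - x\<close> places it inside the inner part,
  so \<open>W\<close> decreases away from the axis. Along the axis, let \<open>g\<close> and \<open>g'\<close> be the half-widths of
  \<open>\<Omega>\<close> at \<open>t < t'\<close> and put \<open>k = g' / g\<close>. The line joining the boundary points above \<open>t\<close> and \<open>t'\<close> meets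
  the axis at the center of the homothety of ratio \<open>k\<close> taking \<open>t\<close> to \<open>t'\<close>; by convexity the forward
  part seen from \<open>t'\<close> lies in \<open>k\<close> times the one seen from \<open>t\<close>, and the opposite inclusion holds for the
  backward parts. As the mass is homogeneous, the ratio of forward to backward mass decreases, hence
  \<open>W\<close> has only one critical point on the axis.
\<close>

subsection \<open>Lebesgue measure and integrals\<close>

lemma set_integrable_abs_powr:
  fixes c R :: real
  assumes "-1 < c"
  shows "set_integrable lborel {-R..R} (\<lambda>x. \<bar>x\<bar> powr c)"
proof (cases "R \<ge> 0")
  case True
  have "(\<lambda>x. x powr c) absolutely_integrable_on {0..R}"
    using integrable_on_powr_from_0[OF assms True]
    by (subst absolutely_integrable_on_iff_nonneg) auto
  then have pos: "integrable lborel (\<lambda>x. indicat_real {0..R} x * x powr c)"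
    unfolding set_integrable_def by (subst (asm) integrable_completion) auto
  have "integrable lborel (\<lambda>x. indicat_real {0..R} (-x) * (-x) powr c)"
    using lborel_integrable_real_affine[OF pos, of "-1" 0] by simp
  then have sum: "integrable lborel
      (\<lambda>x. indicat_real {0..R} x * x powr c + indicat_real {0..R} (-x) * (-x) powr c)"
    using pos by simp
  have "AE x in lborel. indicat_real {0..R} x * x powr c + indicat_real {0..R} (-x) * (-x) powr c =
      indicat_real {-R..R} x *\<^sub>R \<bar>x\<bar> powr c"
    using AE_lborel_singleton[of 0] by eventually_elim (auto simp: indicator_def abs_if)
  then show ?thesis
    unfolding set_integrable_def by (intro integrable_cong_AE_imp[OF sum]) auto
qed (simp add: set_integrable_def)

text \<open>Hyperplanes are null. This later discards the coordinate axes and the lines dividing a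
  body into two halves.\<close>

lemma AE_lborel_inner_neq:
  fixes e x :: "'a::euclidean_space"
  assumes "e \<noteq> 0"
  shows "AE z in lborel. (z - x) \<bullet> e \<noteq> 0"
proof -
  have "negligible {z. e \<bullet> z = e \<bullet> x}"
    using assms by (intro negligible_hyperplane) auto
  then have "AE z in lebesgue. z \<notin> {z. e \<bullet> z = e \<bullet> x}"
    using AE_not_in negligible_iff_null_sets by blast
  then have "AE z in lborel. z \<notin> {z. e \<bullet> z = e \<bullet> x}"
    by (subst (asm) AE_completion_iff) auto
  then show ?thesis
    by eventually_elim (auto simp: inner_diff_right inner_commute[of _ e])
qed

lemma nn_integral_norm_powr_cball:
  fixes a R :: real
  assumes "-2 < a" "a \<le> 0"
  shows "(\<integral>\<^sup>+z\<in>cball (0::real^2) R. ennreal (norm z powr a) \<partial>lborel) < \<infinity>"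
proof -
  \<comment> \<open>Since \<open>a \<le> 0\<close>, the integrand is at most the product of the one-dimensional powers with exponent \<open>a/2\<close>.\<close>
  let ?f = "\<lambda>x::real. ennreal (indicat_real {-R..R} x * \<bar>x\<bar> powr (a/2))"
  have "(\<integral>\<^sup>+z\<in>cball (0::real^2) R. ennreal (norm z powr a) \<partial>lborel)
      \<le> (\<integral>\<^sup>+z. (\<Prod>b\<in>(Basis::(real^2) set). ?f (z \<bullet> b)) \<partial>lborel)"
  proof (rule nn_integral_mono_AE)
    have "AE z in (lborel :: (real^2) measure). \<forall>b\<in>Basis. z \<bullet> b \<noteq> 0"
      by (intro AE_finite_allI) (use AE_lborel_inner_neq[of _ "0::real^2"] nonzero_Basis in force)+
    then show "AE z in lborel. ennreal (norm z powr a) * indicator (cball (0::real^2) R) z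
        \<le> (\<Prod>b\<in>(Basis::(real^2) set). ?f (z \<bullet> b))"
    proof eventually_elim
      case (elim z)
      show ?case
      proof (cases "norm z \<le> R")
        case True
        have "\<bar>z \<bullet> b\<bar> \<le> norm z" if "b \<in> Basis" for b
          using Basis_le_norm that by blast
        then have "norm z powr (a/2) \<le> \<bar>z \<bullet> b\<bar> powr (a/2)" if "b \<in> Basis" for b
          using elim that assms by (intro powr_mono2') auto
        then have "(\<Prod>b\<in>(Basis::(real^2) set). norm z powr (a/2)) \<le> (\<Prod>b\<in>(Basis::(real^2) set). \<bar>z \<bullet> b\<bar> powr (a/2))"
          by (intro prod_mono) auto
        also have "(\<Prod>b\<in>(Basis::(real^2) set). norm z powr (a/2)) = norm z powr a"
          by (simp add: power2_eq_square flip: powr_add)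
        finally have "ennreal (norm z powr a) \<le> (\<Prod>b\<in>(Basis::(real^2) set). ennreal (\<bar>z \<bullet> b\<bar> powr (a/2)))"
          by (simp add: prod_ennreal ennreal_leI)
        also have "\<dots> = (\<Prod>b\<in>(Basis::(real^2) set). ?f (z \<bullet> b))"
        proof (intro prod.cong refl)
          fix b :: "real^2" assume "b \<in> Basis"
          then have "\<bar>z \<bullet> b\<bar> \<le> R" using Basis_le_norm[of b z] True by linarith
          then show "ennreal (\<bar>z \<bullet> b\<bar> powr (a/2)) = ?f (z \<bullet> b)"
            by (simp add: indicator_def abs_le_iff)
        qed
        finally show ?thesis using True by simp
      qed simp
    qed
  qed
  also have "\<dots> = (\<Prod>b\<in>(Basis::(real^2) set). (\<integral>\<^sup>+x. ?f x \<partial>lborel))"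
    by (rule nn_integral_lborel_prod) auto
  also have "(\<integral>\<^sup>+x. ?f x \<partial>lborel) < \<infinity>"
    using set_integrable_abs_powr[of "a/2" R] assms
    unfolding set_integrable_def by (subst nn_integral_eq_integral) auto
  then have "(\<Prod>b\<in>(Basis::(real^2) set). (\<integral>\<^sup>+x. ?f x \<partial>lborel)) < \<infinity>"
    by (simp add: power_less_top_ennreal)
  finally show ?thesis .
qed

lemma lborel_integral_scale:
  fixes f :: "'a::euclidean_space \<Rightarrow> real"
  assumes "k > 0" and [measurable]: "f \<in> borel_measurable borel"
  shows "(\<integral>z. f z \<partial>lborel) = k ^ DIM('a) * (\<integral>z. f (k *\<^sub>R z) \<partial>lborel)"
proof -
  have "(\<integral>z. f z \<partial>lborel) =
      (\<integral>z. f z \<partial>density (distr lborel borel (\<lambda>z. 0 + k *\<^sub>R z)) (\<lambda>_. ennreal (k ^ DIM('a))))"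
    using lborel_affine[of k "0::'a"] assms(1) by simp
  also have "\<dots> = (\<integral>z. k ^ DIM('a) * f z \<partial>distr lborel borel (\<lambda>z. 0 + k *\<^sub>R z))"
    using assms(1) by (subst integral_density) auto
  also have "\<dots> = (\<integral>z. k ^ DIM('a) * f (k *\<^sub>R z) \<partial>lborel)"
    by (subst integral_distr) auto
  finally show ?thesis by simp
qed

text \<open>\<open>lborel\<close> is determined by its values on boxes, and the preimage of a box is
  its image under the orthogonal map \<open>inv T\<close>, which preserves Lebesgue measure.\<close>

lemma lborel_distr_orthogonal_transformation:
  fixes T :: "real^'n::{finite,wellorder} \<Rightarrow> real^'n::_"
  assumes T: "orthogonal_transformation T"
  shows "distr lborel borel T = lborel"
proof (rule lborel_eqI[symmetric])
  have lin: "linear T" and bij: "bij T" and inv: "orthogonal_transformation (inv T)"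
    using T orthogonal_transformation_linear orthogonal_transformation_bij
      orthogonal_transformation_inv by blast+
  have [measurable]: "T \<in> borel_measurable borel"
    using lin by (simp add: borel_measurable_continuous_onI linear_continuous_on linear_linear)
  fix l u :: "real^'n::_" assume le: "\<And>b. b \<in> Basis \<Longrightarrow> l \<bullet> b \<le> u \<bullet> b"
  have eq: "T -` box l u = inv T ` box l u"
    using bij by (simp add: bij_vimage_eq_inv_image)
  have "emeasure (distr lborel borel T) (box l u) = emeasure lborel (T -` box l u)"
    by (simp add: emeasure_distr)
  also have "\<dots> = emeasure lebesgue (T -` box l u)"
    using measurable_sets_borel[of T borel "box l u"] by simp
  also have "\<dots> = ennreal (measure lebesgue (inv T ` box l u))"
    unfolding eq using measurable_orthogonal_image[OF inv lmeasurable_box, of l u]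
    by (metis emeasure_eq_ennreal_measure fmeasurableD2 infinity_ennreal_def)
  also have "\<dots> = ennreal (measure lebesgue (box l u))"
    using measure_orthogonal_image[OF inv lmeasurable_box, of l u] by simp
  also have "\<dots> = ennreal (\<Prod>b\<in>Basis. (u - l) \<bullet> b)"
    using le by (simp add: measure_completion)
  finally show "emeasure (distr lborel borel T) (box l u) = ennreal (\<Prod>b\<in>Basis. (u - l) \<bullet> b)" .
qed simp

subsection \<open>The Riesz kernel and its gradient\<close>

text \<open>With \<open>z = y - x\<close>, this is the rate of change of
  \<open>riesz_kernel \<alpha> (dist y x)\<close> as \<open>x\<close> moves in direction
  \<open>e\<close>.\<close>

definition grad_kernel :: "real \<Rightarrow> real^2 \<Rightarrow> real^2 \<Rightarrow> real" where
  "grad_kernel \<alpha> e z = (z \<bullet> e) * norm z powr (\<alpha> - 4)"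

text \<open>Normalized to have derivative \<open>- (r powr (\<alpha> - 3))\<close> at
  \<open>r > 0\<close> for every \<open>\<alpha>\<close>, the logarithmic case included. Being
  always decreasing, it turns centers into maximum points on both sides of
  \<open>\<alpha> = 2\<close>.\<close>

definition riesz_kernel :: "real \<Rightarrow> real \<Rightarrow> real" where
  "riesz_kernel \<alpha> r = (if \<alpha> = 2 then - ln r else r powr (\<alpha> - 2) / (2 - \<alpha>))"

definition riesz_integral :: "real \<Rightarrow> (real^2) set \<Rightarrow> real^2 \<Rightarrow> real" where
  "riesz_integral \<alpha> \<Omega> x = (\<integral>y\<in>\<Omega>. riesz_kernel \<alpha> (dist y x) \<partial>lborel)"

text \<open>Formally the derivative of \<open>riesz_integral\<close> in direction \<open>e\<close>.
  It is used only through its integrals along segments, so no differentiation under a singular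
  integral occurs.\<close>

definition riesz_flux :: "real \<Rightarrow> real^2 \<Rightarrow> (real^2) set \<Rightarrow> real^2 \<Rightarrow> real" where
  "riesz_flux \<alpha> e \<Omega> x = (\<integral>y\<in>\<Omega>. grad_kernel \<alpha> e (y - x) \<partial>lborel)"

definition kernel_mass :: "real \<Rightarrow> real^2 \<Rightarrow> (real^2) set \<Rightarrow> real" where
  "kernel_mass \<alpha> e S = (\<integral>z\<in>S. \<bar>grad_kernel \<alpha> e z\<bar> \<partial>lborel)"

lemma borel_measurable_grad_kernel [measurable (raw)]:
  assumes [measurable]: "f \<in> borel_measurable M"
  shows "(\<lambda>x. grad_kernel \<alpha> e (f x)) \<in> borel_measurable M"
  unfolding grad_kernel_def by measurable

lemma borel_measurable_riesz_kernel [measurable (raw)]: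
  "f \<in> borel_measurable M \<Longrightarrow> (\<lambda>x. riesz_kernel \<alpha> (f x)) \<in> borel_measurable M"
  unfolding riesz_kernel_def by (cases "\<alpha> = 2") auto

lemma abs_grad_kernel_le:
  assumes "norm e = 1"
  shows "\<bar>grad_kernel \<alpha> e z\<bar> \<le> norm z powr (\<alpha> - 3)"
proof (cases "z = 0")
  case False
  have "\<bar>grad_kernel \<alpha> e z\<bar> = \<bar>z \<bullet> e\<bar> * norm z powr (\<alpha> - 4)"
    by (simp add: grad_kernel_def abs_mult)
  also have "\<dots> \<le> norm z * norm z powr (\<alpha> - 4)"
    using Cauchy_Schwarz_ineq2[of z e] assms by (intro mult_right_mono) auto
  also have "\<dots> = norm z powr (\<alpha> - 3)"
    using False powr_mult_base[of "norm z" "\<alpha> - 4"] by simp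
  finally show ?thesis .
qed (simp add: grad_kernel_def)

text \<open>All translates of the bounded set by vectors of norm at most \<open>r\<close> lie in one
  ball about the origin, so one \<open>C\<close> serves every such \<open>x\<close>. Fubini along a
  segment and the Lipschitz estimate rely on this uniformity.\<close>

lemma nn_integral_grad_kernel_bounded:
  assumes "1 < \<alpha>" "\<alpha> < 3" "norm e = 1" "bounded \<Omega>"
  obtains C where "C \<ge> 0"
    "\<And>x. norm x \<le> r \<Longrightarrow> (\<integral>\<^sup>+y. ennreal (indicator \<Omega> y * \<bar>grad_kernel \<alpha> e (y - x)\<bar>) \<partial>lborel) \<le> ennreal C"
proof -
  obtain R where R: "\<And>y. y \<in> \<Omega> \<Longrightarrow> norm y \<le> R"
    using assms(4) unfolding bounded_iff by blast
  define C where "C = (\<integral>\<^sup>+z\<in>cball (0::real^2) (R + r). ennreal (norm z powr (\<alpha> - 3)) \<partial>lborel)"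
  \<comment> \<open>The bounds on \<open>\<alpha>\<close> enter here: the exponent
    \<open>\<alpha> - 3\<close> lies in (-2, 0), so the singularity is integrable in the
    plane.\<close>
  have fin: "C < \<infinity>"
    unfolding C_def using assms by (intro nn_integral_norm_powr_cball) auto
  have "(\<integral>\<^sup>+y. ennreal (indicator \<Omega> y * \<bar>grad_kernel \<alpha> e (y - x)\<bar>) \<partial>lborel) \<le> C" if "norm x \<le> r" for x
  proof -
    have [measurable]: "cball (0::real^2) (R + r) \<in> sets borel"
      by simp
    let ?f = "\<lambda>z. ennreal (norm z powr (\<alpha> - 3)) * indicator (cball (0::real^2) (R + r)) z"
    have "(\<integral>\<^sup>+y. ennreal (indicator \<Omega> y * \<bar>grad_kernel \<alpha> e (y - x)\<bar>) \<partial>lborel) \<le> (\<integral>\<^sup>+y. ?f (- x + y) \<partial>lborel)"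
    proof (rule nn_integral_mono)
      fix y
      have "norm (y - x) \<le> R + r" if "y \<in> \<Omega>"
        using R[OF that] \<open>norm x \<le> r\<close> norm_triangle_ineq4[of y x] by linarith
      then show "ennreal (indicator \<Omega> y * \<bar>grad_kernel \<alpha> e (y - x)\<bar>) \<le> ?f (- x + y)"
        using abs_grad_kernel_le[OF assms(3)] by (auto simp: indicator_def ennreal_leI)
    qed
    also have "\<dots> = (\<integral>\<^sup>+y. ?f y \<partial>distr lborel borel ((+) (- x)))"
      by (simp add: nn_integral_distr)
    also have "\<dots> = C"
      by (simp only: lborel_distr_plus C_def)
    finally show ?thesis .
  qed
  then show ?thesis
    using that[of "enn2real C"] fin by (simp add: less_top)
qed

lemma set_integrable_grad_kernel:
  assumes "1 < \<alpha>" "\<alpha> < 3" "norm e = 1" "bounded \<Omega>" and [measurable]: "\<Omega> \<in> sets borel"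
  shows "set_integrable lborel \<Omega> (\<lambda>y. grad_kernel \<alpha> e (y - x))"
proof -
  obtain C where C: "(\<integral>\<^sup>+y. ennreal (indicator \<Omega> y * \<bar>grad_kernel \<alpha> e (y - x)\<bar>) \<partial>lborel) \<le> ennreal C"
    using nn_integral_grad_kernel_bounded[OF assms(1-4), of "norm x"] by blast
  show ?thesis
    unfolding set_integrable_def
  proof (rule integrableI_bounded)
    show "(\<integral>\<^sup>+y. ennreal (norm (indicat_real \<Omega> y *\<^sub>R grad_kernel \<alpha> e (y - x))) \<partial>lborel) < \<infinity>"
      using C by (simp add: abs_mult le_less_trans)
  qed measurable
qed

text \<open>By Tonelli it suffices that the inner absolute integral over \<open>y\<close> is bounded
  uniformly in \<open>s\<close>, since the segment has finite length. This is what licenses Fubini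
  below.\<close>

lemma integrable_pair_grad_kernel:
  assumes "1 < \<alpha>" "\<alpha> < 3" "norm e = 1" "bounded \<Omega>" and [measurable]: "\<Omega> \<in> sets borel"
  shows "integrable (lborel \<Otimes>\<^sub>M lborel)
    (\<lambda>(s, y). indicator {a..b} s * (indicator \<Omega> y * grad_kernel \<alpha> e (y - (x + s *\<^sub>R e))))"
proof (rule integrableI_bounded)
  obtain C where "C \<ge> 0" and C: "\<And>w. norm w \<le> norm x + \<bar>a\<bar> + \<bar>b\<bar> \<Longrightarrow>
      (\<integral>\<^sup>+y. ennreal (indicator \<Omega> y * \<bar>grad_kernel \<alpha> e (y - w)\<bar>) \<partial>lborel) \<le> ennreal C"
    using nn_integral_grad_kernel_bounded[OF assms(1-4), of "norm x + \<bar>a\<bar> + \<bar>b\<bar>"] by blast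
  let ?f = "\<lambda>(s, y). indicator {a..b} s * (indicator \<Omega> y * grad_kernel \<alpha> e (y - (x + s *\<^sub>R e)))"
  have "(\<integral>\<^sup>+p. ennreal (norm (?f p)) \<partial>(lborel \<Otimes>\<^sub>M lborel)) =
      (\<integral>\<^sup>+s. \<integral>\<^sup>+y. ennreal (norm (?f (s, y))) \<partial>lborel \<partial>lborel)"
    by (rule lborel.nn_integral_fst[symmetric]) measurable
  also have "\<dots> \<le> (\<integral>\<^sup>+s. ennreal C * indicator {a..b} s \<partial>lborel)"
  proof (rule nn_integral_mono)
    fix s
    show "(\<integral>\<^sup>+y. ennreal (norm (?f (s, y))) \<partial>lborel) \<le> ennreal C * indicator {a..b} s"
    proof (cases "s \<in> {a..b}")
      case True
      have "norm (x + s *\<^sub>R e) \<le> norm x + \<bar>a\<bar> + \<bar>b\<bar>"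
        using True assms(3) norm_triangle_ineq[of x "s *\<^sub>R e"] by auto
      then show ?thesis
        using C True by (simp add: abs_mult)
    qed simp
  qed
  also have "\<dots> < \<infinity>"
    by (simp add: nn_integral_cmult ennreal_mult_less_top emeasure_lborel_Icc_eq)
  finally show "(\<integral>\<^sup>+p. ennreal (norm (?f p)) \<partial>(lborel \<Otimes>\<^sub>M lborel)) < \<infinity>" .
qed measurable

subsection \<open>The potential along a line\<close>

lemma has_real_derivative_riesz_kernel:
  assumes "r > 0"
  shows "(riesz_kernel \<alpha> has_real_derivative - (r powr (\<alpha> - 3))) (at r)"
proof (cases "\<alpha> = 2")
  case True
  then have "riesz_kernel \<alpha> = (\<lambda>r. - ln r)"
    by (auto simp: riesz_kernel_def)
  then show ?thesis
    using assms True by (auto intro!: derivative_eq_intros simp: powr_minus divide_simps)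
next
  case False
  then have eq: "riesz_kernel \<alpha> = (\<lambda>r. r powr (\<alpha> - 2) / (2 - \<alpha>))"
    by (auto simp: riesz_kernel_def)
  have "((\<lambda>r. r powr (\<alpha> - 2) / (2 - \<alpha>)) has_real_derivative
      ((\<alpha> - 2) * r powr (\<alpha> - 2 - 1)) / (2 - \<alpha>)) (at r)"
    using assms by (intro DERIV_cdivide has_real_derivative_powr) auto
  moreover have "((\<alpha> - 2) * r powr (\<alpha> - 2 - 1)) / (2 - \<alpha>) = - (r powr (\<alpha> - 3))"
    using False by (simp add: field_simps)
  ultimately show ?thesis
    unfolding eq by simp
qed

lemma has_vector_derivative_riesz_kernel_line:
  assumes "y \<noteq> x + s *\<^sub>R e"
  shows "((\<lambda>s. riesz_kernel \<alpha> (dist y (x + s *\<^sub>R e))) has_vector_derivative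
    grad_kernel \<alpha> e (y - (x + s *\<^sub>R e))) (at s within A)"
proof -
  let ?z = "y - (x + s *\<^sub>R e)"
  have z: "?z \<noteq> 0" using assms by simp
  have "((\<lambda>s. y - (x + s *\<^sub>R e)) has_derivative (\<lambda>h. - (h *\<^sub>R e))) (at s)"
    by (auto intro!: derivative_eq_intros)
  then have "((\<lambda>s. norm (y - (x + s *\<^sub>R e))) has_derivative (\<lambda>h. sgn ?z \<bullet> (- (h *\<^sub>R e)))) (at s)"
    by (rule has_derivative_compose) (use GDERIV_norm[OF z] in \<open>simp add: gderiv_def inner_commute\<close>)
  moreover have "sgn w \<bullet> (- (h *\<^sub>R e)) = - (w \<bullet> e) / norm w * h" for w h
    by (simp add: sgn_div_norm divide_inverse)
  then have "(\<lambda>h. sgn ?z \<bullet> (- (h *\<^sub>R e))) = (*) (- (?z \<bullet> e) / norm ?z)"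
    by blast
  ultimately have "((\<lambda>s. dist y (x + s *\<^sub>R e)) has_real_derivative (- (?z \<bullet> e) / norm ?z)) (at s)"
    by (simp add: has_field_derivative_def dist_norm)
  then have "((\<lambda>s. riesz_kernel \<alpha> (dist y (x + s *\<^sub>R e))) has_real_derivative
      - (dist y (x + s *\<^sub>R e) powr (\<alpha> - 3)) * (- (?z \<bullet> e) / norm ?z)) (at s)"
    using assms by (intro DERIV_chain2[of "riesz_kernel \<alpha>"] has_real_derivative_riesz_kernel) auto
  moreover have "- (dist y (x + s *\<^sub>R e) powr (\<alpha> - 3)) * (- (?z \<bullet> e) / norm ?z) = grad_kernel \<alpha> e ?z"
    using z powr_mult_base[of "norm ?z" "\<alpha> - 4"]
    by (simp add: grad_kernel_def dist_norm divide_simps) (simp add: mult_ac)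
  ultimately show ?thesis
    by (metis has_real_derivative_iff_has_vector_derivative has_vector_derivative_at_within)
qed

text \<open>For \<open>y\<close> off the whole line the integrand is continuous, so the fundamental
  theorem of calculus applies; the excluded \<open>y\<close> form a null set.\<close>

lemma integral_grad_kernel_line:
  assumes "a \<le> b" "\<And>s. y \<noteq> x + s *\<^sub>R e"
  shows "(\<integral>s. indicator {a..b} s * grad_kernel \<alpha> e (y - (x + s *\<^sub>R e)) \<partial>lborel) =
    riesz_kernel \<alpha> (dist y (x + b *\<^sub>R e)) - riesz_kernel \<alpha> (dist y (x + a *\<^sub>R e))"
proof -
  have "continuous_on {a..b} (\<lambda>s. grad_kernel \<alpha> e (y - (x + s *\<^sub>R e)))"
    unfolding grad_kernel_def using assms(2) by (intro continuous_intros) auto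
  then show ?thesis
    using integral_FTC_atLeastAtMost[OF assms(1) has_vector_derivative_riesz_kernel_line[OF assms(2)]]
    by simp
qed

lemma AE_not_on_line:
  fixes x e :: "real^2"
  shows "AE y in lborel. \<forall>s. y \<noteq> x + s *\<^sub>R e"
proof -
  \<comment> \<open>The line lies in the hyperplane through \<open>x\<close> normal to
    \<open>u\<close>, which is null.\<close>
  obtain u :: "real^2" where "u \<noteq> 0" "orthogonal e u"
    using orthogonal_to_vector_exists[of e] by auto
  then show ?thesis
    using AE_lborel_inner_neq[of u x] by (auto elim!: eventually_mono simp: orthogonal_def)
qed

lemma continuous_on_riesz_kernel: "continuous_on {0<..} (riesz_kernel \<alpha>)"
  using DERIV_isCont[OF has_real_derivative_riesz_kernel]
  by (intro continuous_at_imp_continuous_on) auto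

lemma AE_integral_grad_kernel_line:
  assumes "a \<le> b"
  shows "AE y in lborel. (\<integral>s. indicator {a..b} s * (indicator \<Omega> y * grad_kernel \<alpha> e (y - (x + s *\<^sub>R e))) \<partial>lborel) =
    indicator \<Omega> y * riesz_kernel \<alpha> (dist y (x + b *\<^sub>R e)) - indicator \<Omega> y * riesz_kernel \<alpha> (dist y (x + a *\<^sub>R e))"
  using AE_not_on_line[of x e]
proof eventually_elim
  case (elim y)
  then show ?case
    using integral_grad_kernel_line[OF assms, of y x e \<alpha>] by (cases "y \<in> \<Omega>") auto
qed

lemma set_integrable_riesz_kernel:
  fixes \<Omega> :: "(real^2) set"
  assumes "1 < \<alpha>" "\<alpha> < 3" "compact \<Omega>"
  shows "set_integrable lborel \<Omega> (\<lambda>y. riesz_kernel \<alpha> (dist y x))"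
proof -
  obtain e :: "real^2" where e: "norm e = 1"
    using vector_choose_size[of 1] by auto
  have [measurable]: "\<Omega> \<in> sets borel" and bd: "bounded \<Omega>"
    using assms(3) by (auto simp: compact_imp_closed compact_imp_bounded)
  obtain M where M: "M > 0" "\<And>y. y \<in> \<Omega> \<Longrightarrow> dist y x < M"
    using bounded_subset_ballD[OF bd, of x] by (auto simp: subset_eq dist_commute)
  \<comment> \<open>The kernel centered at the distant point \<open>a\<close> is continuous on \<open>\<Omega>\<close>; moving from \<open>a\<close> to \<open>x\<close> adds an
    integrable function by Fubini.\<close>
  define a where "a = x - M *\<^sub>R e"
  have far: "y \<noteq> a" if "y \<in> \<Omega>" for y
    using M(2)[OF that] M(1) e by (auto simp: a_def dist_norm)
  have "continuous_on \<Omega> (\<lambda>y. riesz_kernel \<alpha> (dist y a))"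
    using far by (intro continuous_on_compose2[OF continuous_on_riesz_kernel]) (auto intro!: continuous_intros)
  then have "set_integrable lborel \<Omega> (\<lambda>y. riesz_kernel \<alpha> (dist y a))"
    unfolding set_integrable_def by (rule borel_integrable_compact[OF assms(3)])
  then have int1: "integrable lborel (\<lambda>y. indicator \<Omega> y * riesz_kernel \<alpha> (dist y a))"
    by (simp add: set_integrable_def)
  have int2: "integrable lborel (\<lambda>y. \<integral>s. indicator {0..M} s * (indicator \<Omega> y * grad_kernel \<alpha> e (y - (a + s *\<^sub>R e))) \<partial>lborel)"
    using lborel_pair.integrable_snd[OF integrable_pair_grad_kernel[OF assms(1,2) e bd, of 0 M a]] by simp
  have "AE y in lborel. (\<integral>s. indicator {0..M} s * (indicator \<Omega> y * grad_kernel \<alpha> e (y - (a + s *\<^sub>R e))) \<partial>lborel)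
      + indicator \<Omega> y * riesz_kernel \<alpha> (dist y a) = indicator \<Omega> y *\<^sub>R riesz_kernel \<alpha> (dist y x)"
    using AE_integral_grad_kernel_line[of 0 M \<Omega> \<alpha> e a] M(1) by (auto elim!: eventually_mono simp: a_def)
  then show ?thesis
    unfolding set_integrable_def
    by (intro integrable_cong_AE_imp[OF Bochner_Integration.integrable_add[OF int2 int1]]) auto
qed

text \<open>Integral form of the statement that the flux is the derivative: exchange the integrals
  over \<open>s\<close> and \<open>y\<close>, then integrate over \<open>s\<close> for almost every
  fixed \<open>y\<close>.\<close>

lemma riesz_integral_diff:
  assumes "1 < \<alpha>" "\<alpha> < 3" "compact \<Omega>" "norm e = 1" "a \<le> b"
  shows "set_integrable lborel {a..b} (\<lambda>s. riesz_flux \<alpha> e \<Omega> (x + s *\<^sub>R e))" (is ?int)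
    and "riesz_integral \<alpha> \<Omega> (x + b *\<^sub>R e) - riesz_integral \<alpha> \<Omega> (x + a *\<^sub>R e) =
      (\<integral>s\<in>{a..b}. riesz_flux \<alpha> e \<Omega> (x + s *\<^sub>R e) \<partial>lborel)" (is ?eq)
proof -
  have [measurable]: "\<Omega> \<in> sets borel" and bd: "bounded \<Omega>"
    using assms(3) by (auto simp: compact_imp_closed compact_imp_bounded)
  let ?f = "\<lambda>s y. indicator {a..b} s * (indicator \<Omega> y * grad_kernel \<alpha> e (y - (x + s *\<^sub>R e)))"
  have pair: "integrable (lborel \<Otimes>\<^sub>M lborel) (\<lambda>(s, y). ?f s y)"
    by (rule integrable_pair_grad_kernel) (use assms bd in auto)
  have inner: "(\<integral>y. ?f s y \<partial>lborel) = indicator {a..b} s *\<^sub>R riesz_flux \<alpha> e \<Omega> (x + s *\<^sub>R e)" for s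
    by (simp add: riesz_flux_def set_lebesgue_integral_def)
  show ?int
    unfolding set_integrable_def using lborel_pair.integrable_fst[OF pair] by (simp only: inner)
  have K: "integrable lborel (\<lambda>y. indicator \<Omega> y * riesz_kernel \<alpha> (dist y w))" for w
    using set_integrable_riesz_kernel[OF assms(1-3)] by (simp add: set_integrable_def)
  have "(\<integral>s\<in>{a..b}. riesz_flux \<alpha> e \<Omega> (x + s *\<^sub>R e) \<partial>lborel) = (\<integral>s. \<integral>y. ?f s y \<partial>lborel \<partial>lborel)"
    by (simp only: inner set_lebesgue_integral_def)
  also have "\<dots> = (\<integral>y. \<integral>s. ?f s y \<partial>lborel \<partial>lborel)"
    using lborel_pair.Fubini_integral[OF pair] by simp
  also have "\<dots> = (\<integral>y. indicator \<Omega> y * riesz_kernel \<alpha> (dist y (x + b *\<^sub>R e)) - indicator \<Omega> y * riesz_kernel \<alpha> (dist y (x + a *\<^sub>R e)) \<partial>lborel)"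
    by (intro integral_cong_AE AE_integral_grad_kernel_line assms) measurable
  also have "\<dots> = riesz_integral \<alpha> \<Omega> (x + b *\<^sub>R e) - riesz_integral \<alpha> \<Omega> (x + a *\<^sub>R e)"
    using K by (simp add: riesz_integral_def set_lebesgue_integral_def)
  finally show ?eq by simp
qed

lemma riesz_flux_bounded:
  assumes "1 < \<alpha>" "\<alpha> < 3" "norm e = 1" "compact \<Omega>"
  obtains C where "\<And>x. norm x \<le> r \<Longrightarrow> \<bar>riesz_flux \<alpha> e \<Omega> x\<bar> \<le> C"
proof -
  have [measurable]: "\<Omega> \<in> sets borel" and bd: "bounded \<Omega>"
    using assms(4) by (auto simp: compact_imp_closed compact_imp_bounded)
  obtain C where "C \<ge> 0" and C: "\<And>x. norm x \<le> r \<Longrightarrow>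
      (\<integral>\<^sup>+y. ennreal (indicator \<Omega> y * \<bar>grad_kernel \<alpha> e (y - x)\<bar>) \<partial>lborel) \<le> ennreal C"
    using nn_integral_grad_kernel_bounded[OF assms(1-3) bd] by blast
  have "\<bar>riesz_flux \<alpha> e \<Omega> x\<bar> \<le> C" if "norm x \<le> r" for x
  proof -
    have "ennreal (norm (riesz_flux \<alpha> e \<Omega> x)) \<le> (\<integral>\<^sup>+y. norm (indicat_real \<Omega> y *\<^sub>R grad_kernel \<alpha> e (y - x)) \<partial>lborel)"
      unfolding riesz_flux_def set_lebesgue_integral_def
      using set_integrable_grad_kernel[OF assms(1-3) bd, of x]
      by (intro integral_norm_bound_ennreal) (simp add: set_integrable_def)
    also have "\<dots> \<le> ennreal C"
      using C[OF that] by (simp add: abs_mult)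
    finally show ?thesis using \<open>C \<ge> 0\<close> by simp
  qed
  then show ?thesis using that by blast
qed

text \<open>The flux is bounded on the segment, so its integral is Lipschitz. Continuity yields the
  maximum on the axis.\<close>

lemma continuous_on_riesz_integral_line:
  assumes "1 < \<alpha>" "\<alpha> < 3" "norm e = 1" "compact \<Omega>"
  shows "continuous_on {a..b} (\<lambda>s. riesz_integral \<alpha> \<Omega> (x + s *\<^sub>R e))"
proof -
  obtain C where C: "\<And>w. norm w \<le> norm x + \<bar>a\<bar> + \<bar>b\<bar> \<Longrightarrow> \<bar>riesz_flux \<alpha> e \<Omega> w\<bar> \<le> C"
    using riesz_flux_bounded[OF assms] by blast
  have le: "\<bar>riesz_integral \<alpha> \<Omega> (x + d *\<^sub>R e) - riesz_integral \<alpha> \<Omega> (x + c *\<^sub>R e)\<bar> \<le> C * (d - c)"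
    if "a \<le> c" "c \<le> d" "d \<le> b" for c d
  proof -
    have "\<bar>\<integral>s\<in>{c..d}. riesz_flux \<alpha> e \<Omega> (x + s *\<^sub>R e) \<partial>lborel\<bar> \<le> (\<integral>s\<in>{c..d}. C \<partial>lborel)"
    proof -
      have int: "set_integrable lborel {c..d} (\<lambda>s. riesz_flux \<alpha> e \<Omega> (x + s *\<^sub>R e))"
        by (rule riesz_integral_diff(1)[OF assms(1,2,4,3) that(2)])
      have "norm (\<integral>s\<in>{c..d}. riesz_flux \<alpha> e \<Omega> (x + s *\<^sub>R e) \<partial>lborel)
          \<le> (\<integral>s\<in>{c..d}. norm (riesz_flux \<alpha> e \<Omega> (x + s *\<^sub>R e)) \<partial>lborel)"
        by (rule set_integral_norm_bound[OF int])
      also have "\<dots> \<le> (\<integral>s\<in>{c..d}. C \<partial>lborel)"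
      proof (rule set_integral_mono)
        show "set_integrable lborel {c..d} (\<lambda>s. norm (riesz_flux \<alpha> e \<Omega> (x + s *\<^sub>R e)))"
          using int by (rule set_integrable_norm)
        show "set_integrable lborel {c..d} (\<lambda>s. C)"
          by (intro borel_integrable_atLeastAtMost') auto
        fix s assume "s \<in> {c..d}"
        then have "norm (x + s *\<^sub>R e) \<le> norm x + \<bar>a\<bar> + \<bar>b\<bar>"
          using that assms(3) norm_triangle_ineq[of x "s *\<^sub>R e"] by auto
        then show "norm (riesz_flux \<alpha> e \<Omega> (x + s *\<^sub>R e)) \<le> C"
          using C by simp
      qed
      finally show ?thesis by simp
    qed
    then show ?thesis
      using that riesz_integral_diff(2)[OF assms(1,2,4,3), of c d x]
      by (simp add: set_lebesgue_integral_def mult.commute)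
  qed
  \<comment> \<open>The bound \<open>C\<close> comes without a sign, while a Lipschitz constant has
    to be nonnegative.\<close>
  have "\<bar>C\<bar>-lipschitz_on {a..b} (\<lambda>s. riesz_integral \<alpha> \<Omega> (x + s *\<^sub>R e))"
  proof (rule lipschitz_onI)
    fix c d assume cd: "c \<in> {a..b}" "d \<in> {a..b}"
    let ?W = "\<lambda>s. riesz_integral \<alpha> \<Omega> (x + s *\<^sub>R e)"
    have "\<bar>?W (max c d) - ?W (min c d)\<bar> \<le> C * (max c d - min c d)"
      using cd by (intro le) auto
    also have "\<dots> \<le> \<bar>C\<bar> * (max c d - min c d)"
      by (intro mult_right_mono) auto
    finally show "dist (?W c) (?W d) \<le> \<bar>C\<bar> * dist c d"
      by (cases "c \<le> d") (simp_all add: dist_real_def abs_minus_commute max_def min_def)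
  qed simp
  then show ?thesis
    by (rule lipschitz_on_continuous_on)
qed

subsection \<open>Mass and homotheties\<close>

lemma integrable_kernel_mass:
  assumes "1 < \<alpha>" "\<alpha> < 3" "norm e = 1" "bounded S" "S \<in> sets borel"
  shows "set_integrable lborel S (\<lambda>z. \<bar>grad_kernel \<alpha> e z\<bar>)"
  using set_integrable_abs[OF set_integrable_grad_kernel[OF assms, of 0]] by simp

lemma kernel_mass_nonneg: "0 \<le> kernel_mass \<alpha> e S"
  unfolding kernel_mass_def set_lebesgue_integral_def by (intro integral_nonneg_AE) auto

lemma kernel_mass_Diff:
  assumes "1 < \<alpha>" "\<alpha> < 3" "norm e = 1" "bounded T" "S \<in> sets borel" "T \<in> sets borel" "S \<subseteq> T"
  shows "kernel_mass \<alpha> e T = kernel_mass \<alpha> e S + kernel_mass \<alpha> e (T - S)"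
proof -
  have "kernel_mass \<alpha> e T = kernel_mass \<alpha> e (S \<union> (T - S))"
    using assms(7) by (simp add: Un_absorb1)
  also have "\<dots> = kernel_mass \<alpha> e S + kernel_mass \<alpha> e (T - S)"
    unfolding kernel_mass_def using assms
    by (intro set_integral_Un integrable_kernel_mass) (auto intro: bounded_subset)
  finally show ?thesis .
qed

lemma kernel_mass_mono:
  assumes "1 < \<alpha>" "\<alpha> < 3" "norm e = 1" "bounded T" "S \<in> sets borel" "T \<in> sets borel" "S \<subseteq> T"
  shows "kernel_mass \<alpha> e S \<le> kernel_mass \<alpha> e T"
  using kernel_mass_Diff[OF assms] kernel_mass_nonneg[of \<alpha> e "T - S"] by linarith

lemma grad_kernel_eq_0_iff: "grad_kernel \<alpha> e z = 0 \<longleftrightarrow> z \<bullet> e = 0"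
  by (auto simp: grad_kernel_def)

text \<open>The density is positive except on the null line
  \<open>z \<bullet> e = 0\<close>.\<close>

lemma kernel_mass_eq_0_imp:
  assumes "1 < \<alpha>" "\<alpha> < 3" "norm e = 1" "bounded S" "S \<in> sets borel"
    and "kernel_mass \<alpha> e S = 0"
  shows "measure lborel S = 0"
proof -
  have "AE z in lborel. indicat_real S z *\<^sub>R \<bar>grad_kernel \<alpha> e z\<bar> = 0"
    using integrable_kernel_mass[OF assms(1-5)] assms(6)
    unfolding kernel_mass_def set_lebesgue_integral_def set_integrable_def
    by (subst (asm) integral_nonneg_eq_0_iff_AE) auto
  moreover have "e \<noteq> 0"
    using assms(3) by auto
  then have "AE z in lborel. z \<bullet> e \<noteq> 0"
    using AE_lborel_inner_neq[of e 0] by simp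
  ultimately have "AE z in lborel. z \<notin> S"
    by eventually_elim (auto simp: grad_kernel_eq_0_iff)
  then have "emeasure lborel S = 0"
    using assms(5) by (subst (asm) AE_iff_measurable[of S]) auto
  then show ?thesis by (simp add: measure_def)
qed

text \<open>Equality case of monotonicity: the difference has mass zero, hence area zero. Strict
  inequalities between masses are thereby reduced to areas.\<close>

lemma kernel_mass_eq_imp:
  assumes "1 < \<alpha>" "\<alpha> < 3" "norm e = 1" "bounded T" "S \<in> sets borel" "T \<in> sets borel" "S \<subseteq> T"
    and "kernel_mass \<alpha> e T \<le> kernel_mass \<alpha> e S"
  shows "measure lborel S = measure lborel T"
proof -
  have "kernel_mass \<alpha> e (T - S) = 0"
    using kernel_mass_Diff[OF assms(1-7)] assms(8) kernel_mass_nonneg[of \<alpha> e "T - S"] by linarith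
  then have "measure lborel (T - S) = 0"
    using assms by (intro kernel_mass_eq_0_imp[OF assms(1-3)]) (auto intro: bounded_subset)
  moreover have "measure lborel (T - S) = measure lborel T - measure lborel S"
    using assms(4-7) emeasure_bounded_finite[OF assms(4)] by (intro measure_Diff) (auto simp: less_top)
  ultimately show ?thesis by simp
qed

lemma kernel_mass_pos:
  assumes "1 < \<alpha>" "\<alpha> < 3" "norm e = 1" "bounded S" "S \<in> sets borel" "measure lborel S \<noteq> 0"
  shows "0 < kernel_mass \<alpha> e S"
  using kernel_mass_eq_0_imp[OF assms(1-5)] kernel_mass_nonneg[of \<alpha> e S] assms(6) by fastforce

lemma kernel_mass_null:
  assumes "S \<in> sets borel" "bounded S" "measure lborel S = 0"
  shows "kernel_mass \<alpha> e S = 0"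
proof -
  have "emeasure lborel S = 0"
    using assms(3) emeasure_bounded_finite[OF assms(2)]
    by (simp add: emeasure_eq_ennreal_measure less_top[symmetric])
  then have "AE z in lborel. z \<notin> S"
    using assms(1) by (intro AE_not_in) auto
  then have "AE z in lborel. indicat_real S z *\<^sub>R \<bar>grad_kernel \<alpha> e z\<bar> = 0"
    by eventually_elim simp
  then show ?thesis
    unfolding kernel_mass_def set_lebesgue_integral_def by (rule integral_eq_zero_AE)
qed

section \<open>Area and mass under dilations\<close>

lemma indicator_scaleR_image:
  "(k::real) > 0 \<Longrightarrow> indicator ((*\<^sub>R) k ` S) (k *\<^sub>R z) = indicator S (z :: 'a::real_vector)"
  by (auto simp: indicator_def)

lemma sets_borel_scaleR_image:
  fixes S :: "'a::euclidean_space set"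
  assumes "k > 0" "S \<in> sets borel"
  shows "(*\<^sub>R) k ` S \<in> sets borel"
proof -
  have "(*\<^sub>R) k ` S = (*\<^sub>R) (1/k) -` S \<inter> space borel"
    using assms(1) by (force simp: image_iff)
  also have "\<dots> \<in> sets borel"
    by (rule measurable_sets[OF _ assms(2)]) measurable
  finally show ?thesis .
qed

lemma measure_lborel_scaleR_image:
  fixes S :: "'a::euclidean_space set"
  assumes "k > 0" and [measurable]: "S \<in> sets borel"
  shows "measure lborel ((*\<^sub>R) k ` S) = k ^ DIM('a) * measure lborel S"
proof -
  have [measurable]: "(*\<^sub>R) k ` S \<in> sets borel"
    using assms by (rule sets_borel_scaleR_image)
  have "measure lborel ((*\<^sub>R) k ` S) = (\<integral>z. indicator ((*\<^sub>R) k ` S) z \<partial>lborel)"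
    by simp
  also have "\<dots> = k ^ DIM('a) * (\<integral>z. indicator ((*\<^sub>R) k ` S) (k *\<^sub>R z) \<partial>lborel)"
    by (intro lborel_integral_scale assms) measurable
  finally show ?thesis
    using assms(1) by (simp add: indicator_scaleR_image)
qed

text \<open>Area contributes \<open>k ^ 2\<close> and the kernel is homogeneous of degree
  \<open>\<alpha> - 3\<close>. The factor is the same for every set, so a comparison of two masses
  survives dilation.\<close>

lemma kernel_mass_scaleR_image:
  assumes "k > 0" and [measurable]: "S \<in> sets borel"
  shows "kernel_mass \<alpha> e ((*\<^sub>R) k ` S) = k powr (\<alpha> - 1) * kernel_mass \<alpha> e S"
proof -
  have [measurable]: "(*\<^sub>R) k ` S \<in> sets borel"
    using assms by (rule sets_borel_scaleR_image)
  have "k ^ 2 * (k * k powr (\<alpha> - 4)) = k powr 2 * (k powr 1 * k powr (\<alpha> - 4))"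
    using assms(1) by simp
  also have "\<dots> = k powr (\<alpha> - 1)"
    by (simp only: powr_add[symmetric]) simp
  finally have pw: "k ^ 2 * (k * k powr (\<alpha> - 4)) = k powr (\<alpha> - 1)" .
  have grad: "\<bar>grad_kernel \<alpha> e (k *\<^sub>R z)\<bar> = (k * k powr (\<alpha> - 4)) * \<bar>grad_kernel \<alpha> e z\<bar>" for z
    using assms(1) by (simp add: grad_kernel_def abs_mult powr_mult)
  have "kernel_mass \<alpha> e ((*\<^sub>R) k ` S) =
      k ^ 2 * (\<integral>z. indicator ((*\<^sub>R) k ` S) (k *\<^sub>R z) * \<bar>grad_kernel \<alpha> e (k *\<^sub>R z)\<bar> \<partial>lborel)"
    unfolding kernel_mass_def set_lebesgue_integral_def
    by (subst lborel_integral_scale[OF assms(1)]) auto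
  also have "\<dots> = k ^ 2 * (\<integral>z. (k * k powr (\<alpha> - 4)) * (indicator S z * \<bar>grad_kernel \<alpha> e z\<bar>) \<partial>lborel)"
    using assms(1) by (simp add: indicator_scaleR_image grad mult_ac)
  also have "\<dots> = k powr (\<alpha> - 1) * kernel_mass \<alpha> e S"
    unfolding kernel_mass_def set_lebesgue_integral_def by (simp add: pw[symmetric])
  finally show ?thesis .
qed

subsection \<open>Half bodies\<close>

text \<open>The segment from \<open>(t, g)\<close> to \<open>(t' + x, y)\<close> crosses the section
  at \<open>t'\<close> at height at most \<open>g'\<close>. This bounds \<open>y\<close>, and the
  bound says exactly that the line from \<open>(t' + x, y)\<close> through its image under the
  homothety meets the section at \<open>t\<close> no higher than \<open>g\<close>.\<close>

lemma convex_half_section_scaling: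
  fixes C :: "(real \<times> real) set"
  assumes "convex C" and sym: "\<And>a b. (a, b) \<in> C \<Longrightarrow> (a, - b) \<in> C"
    and "t < t'" "0 < g" "0 < g'" "(t, g) \<in> C" and top: "\<And>b. (t', b) \<in> C \<Longrightarrow> b \<le> g'"
    and "0 \<le> x" "(t' + x, y) \<in> C"
  shows "(t + x * (g / g'), y * (g / g')) \<in> C"
proof -
  have comb: "((1 - l) * a + l * c, (1 - l) * b + l * d) \<in> C"
    if "(a, b) \<in> C" "(c, d) \<in> C" "0 \<le> l" "l \<le> 1" for a b c d l
    using convexD_alt[OF assms(1) that] by simp
  have nonneg: "(t + x * (g / g'), y * (g / g')) \<in> C" if P: "(t' + x, y) \<in> C" and "0 \<le> y" for y
  proof -
    define d where "d = t' - t"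
    define q where "q = g / g'"
    \<comment> \<open>Horizontal displacement from the image point, at abscissa
      \<open>t + x * q\<close>, to the given point at \<open>t' + x\<close>.\<close>
    define D where "D = d + x - x * q"
    have "0 < d" "0 < q" "q * g' = g"
      using assms by (auto simp: d_def q_def)
    \<comment> \<open>The weight \<open>x / (d + x)\<close> on \<open>(t, g)\<close> places the
      convex combination with \<open>(t' + x, y)\<close> at abscissa \<open>t'\<close>.\<close>
    have "x / (d + x) * (d + x) = x"
      using \<open>0 < d\<close> \<open>0 \<le> x\<close> by simp
    moreover have "(1 - l) * (t' + x) + l * t = t' + x - l * (d + x)" for l
      by (simp add: d_def algebra_simps)
    ultimately have "(1 - x / (d + x)) * (t' + x) + x / (d + x) * t = t'"
      by (metis add_diff_cancel_right')
    moreover have "1 - x / (d + x) = d / (d + x)"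
      using \<open>0 < d\<close> \<open>0 \<le> x\<close> by (simp add: field_simps)
    then have "(1 - x / (d + x)) * y + x / (d + x) * g = (d * y + x * g) / (d + x)"
      by (simp add: add_divide_distrib)
    ultimately have "(t', (d * y + x * g) / (d + x)) \<in> C"
      using comb[OF P \<open>(t, g) \<in> C\<close>, of "x / (d + x)"] \<open>0 < d\<close> \<open>0 \<le> x\<close> by simp
    then have "(d * y + x * g) / (d + x) \<le> g'"
      by (rule top)
    then have "d * y + x * g \<le> g' * (d + x)"
      using \<open>0 < d\<close> \<open>0 \<le> x\<close> by (simp add: field_simps)
    moreover have "g' * D = g' * (d + x) - x * g"
      unfolding D_def \<open>q * g' = g\<close>[symmetric] by (simp add: algebra_simps)
    ultimately have dy: "d * y \<le> g' * D"
      by simp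
    then have "0 \<le> g' * D"
      using \<open>0 < d\<close> \<open>0 \<le> y\<close> by (meson mult_nonneg_nonneg less_imp_le order_trans)
    then have "0 \<le> D"
      using \<open>0 < g'\<close> by (simp add: zero_le_mult_iff)
    show ?thesis
    proof (cases "D = 0")
      case True
      then have "y = 0"
        using dy \<open>0 < d\<close> \<open>0 \<le> y\<close> by (simp add: mult_le_0_iff)
      moreover have "t + x * q = t' + x"
        using True by (simp add: D_def d_def)
      ultimately show ?thesis
        using P by (simp add: q_def)
    next
      case False
      with \<open>0 \<le> D\<close> have "0 < D" by simp
      \<comment> \<open>\<open>(t, h)\<close> is where the line through \<open>(t' + x, y)\<close> and its image meets the section at \<open>t\<close>;
        the image lies between these two points of \<open>C\<close>.\<close>
      define h where "h = y * q * d / D"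
      have "0 \<le> h"
        using \<open>0 < D\<close> \<open>0 < d\<close> \<open>0 < q\<close> \<open>0 \<le> y\<close> by (simp add: h_def)
      have "h \<le> g"
      proof -
        have "y * q * d \<le> g' * D * q"
          using mult_right_mono[OF dy, of q] \<open>0 < q\<close> by (simp add: mult_ac)
        also have "\<dots> = g * D"
          using \<open>q * g' = g\<close> by (simp add: mult_ac)
        finally show ?thesis
          using \<open>0 < D\<close> by (simp add: h_def divide_le_eq)
      qed
      \<comment> \<open>Position of \<open>(t, h)\<close> on the vertical segment from
        \<open>(t, - g)\<close> to \<open>(t, g)\<close>.\<close>
      define m where "m = (1 + h / g) / 2"
      have m: "0 \<le> m" "m \<le> 1"
        using \<open>0 \<le> h\<close> \<open>h \<le> g\<close> \<open>0 < g\<close> by (auto simp: m_def)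
      have "(1 - m) * t + m * t = t" "(1 - m) * - g + m * g = h"
        using \<open>0 < g\<close> by (simp_all add: m_def field_simps)
      then have R: "(t, h) \<in> C"
        using comb[OF sym[OF \<open>(t, g) \<in> C\<close>] \<open>(t, g) \<in> C\<close> m] by (simp only:)
      \<comment> \<open>Fraction of the way from abscissa \<open>t\<close> to \<open>t' + x\<close>
        at which the image lies.\<close>
      define l where "l = x * q / (d + x)"
      have l: "0 \<le> l" "l \<le> 1"
        using \<open>0 < d\<close> \<open>0 < q\<close> \<open>0 \<le> x\<close> \<open>0 \<le> D\<close> by (auto simp: l_def D_def)
      have "1 - l = D / (d + x)"
        using \<open>0 < d\<close> \<open>0 \<le> x\<close> by (simp add: l_def D_def diff_divide_distrib)
      then have "(1 - l) * h + l * y = (y * q * d + x * q * y) / (d + x)"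
        using \<open>0 < D\<close> by (simp add: h_def l_def add_divide_distrib)
      also have "\<dots> = y * q"
        using \<open>0 < d\<close> \<open>0 \<le> x\<close> by (simp add: field_simps)
      finally have "(1 - l) * h + l * y = y * q" .
      moreover have "(1 - l) * t + l * (t' + x) = t + l * (d + x)"
        by (simp add: d_def algebra_simps)
      then have "(1 - l) * t + l * (t' + x) = t + x * q"
        using \<open>0 < d\<close> \<open>0 \<le> x\<close> by (simp add: l_def)
      ultimately show ?thesis
        using comb[OF R P l] by (simp add: q_def)
    qed
  qed
  show ?thesis
  proof (cases "0 \<le> y")
    case False
    then show ?thesis
      using sym[OF nonneg[OF sym[OF assms(9)]]] by simp
  qed (use nonneg assms(9) in blast)
qed

text \<open>Translated so that \<open>x\<close> becomes the origin: a homothety taking one viewpoint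
  to another is then multiplication by a scalar.\<close>

definition half_body :: "(real^2) set \<Rightarrow> real^2 \<Rightarrow> real^2 \<Rightarrow> (real^2) set" where
  "half_body \<Omega> x e = {z. x + z \<in> \<Omega> \<and> 0 < z \<bullet> e}"

lemma half_body_borel:
  assumes "\<Omega> \<in> sets borel"
  shows "half_body \<Omega> x e \<in> sets borel"
proof -
  have [measurable]: "{z. x + z \<in> \<Omega>} \<in> sets borel"
    using measurable_sets[of "(+) x" borel borel, OF _ assms] by (simp add: vimage_def)
  have "half_body \<Omega> x e = {z. x + z \<in> \<Omega>} \<inter> {z. 0 < e \<bullet> z}"
    by (auto simp: half_body_def inner_commute)
  also have "\<dots> \<in> sets borel"
    by (intro sets.Int) (auto simp: open_halfspace_gt)
  finally show ?thesis .
qed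

lemma half_body_bounded:
  assumes "bounded \<Omega>"
  shows "bounded (half_body \<Omega> x e)"
proof (rule bounded_subset)
  show "bounded ((\<lambda>y. - x + y) ` \<Omega>)"
    using assms by (rule bounded_translation)
  show "half_body \<Omega> x e \<subseteq> (\<lambda>y. - x + y) ` \<Omega>"
  proof
    fix z assume "z \<in> half_body \<Omega> x e"
    then show "z \<in> (\<lambda>y. - x + y) ` \<Omega>"
      by (intro image_eqI[of _ _ "x + z"]) (auto simp: half_body_def)
  qed
qed

lemma integral_lborel_translation:
  fixes f :: "'a::euclidean_space \<Rightarrow> real"
  assumes [measurable]: "f \<in> borel_measurable borel"
  shows "(\<integral>z. f (x + z) \<partial>lborel) = (\<integral>y. f y \<partial>lborel)"
proof -
  have "(\<integral>z. f (x + z) \<partial>lborel) = (\<integral>y. f y \<partial>distr lborel borel ((+) x))"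
    by (subst integral_distr) auto
  then show ?thesis
    by (simp add: lborel_distr_plus)
qed

text \<open>Back in the coordinates of \<Omega>, half bodies seen from different points in one
  direction are nested, which makes their areas comparable.\<close>

lemma measure_half_body:
  assumes [measurable]: "\<Omega> \<in> sets borel"
  shows "measure lborel (half_body \<Omega> x e) = measure lborel {y \<in> \<Omega>. 0 < (y - x) \<bullet> e}"
proof -
  have [measurable]: "{y \<in> \<Omega>. 0 < (y - x) \<bullet> e} \<in> sets borel"
    by measurable
  have "measure lborel (half_body \<Omega> x e) = (\<integral>z. indicator (half_body \<Omega> x e) z \<partial>lborel)"
    by simp
  also have "\<dots> = (\<integral>z. indicator {y \<in> \<Omega>. 0 < (y - x) \<bullet> e} (x + z) \<partial>lborel)"
    by (intro Bochner_Integration.integral_cong) (auto simp: half_body_def indicator_def)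
  also have "\<dots> = measure lborel {y \<in> \<Omega>. 0 < (y - x) \<bullet> e}"
    by (subst integral_lborel_translation) auto
  finally show ?thesis .
qed

lemma measure_half_body_add:
  assumes [measurable]: "\<Omega> \<in> sets borel" and "bounded \<Omega>" "e \<noteq> 0"
  shows "measure lborel \<Omega> = measure lborel (half_body \<Omega> x e) + measure lborel (half_body \<Omega> x (- e))"
proof -
  let ?A = "{y \<in> \<Omega>. 0 < (y - x) \<bullet> e}" and ?B = "{y \<in> \<Omega>. 0 < (y - x) \<bullet> (- e)}"
  have sets: "?A \<in> sets borel" "?B \<in> sets borel"
    by measurable
  have fin: "emeasure lborel S \<noteq> \<infinity>" if "S \<subseteq> \<Omega>" for S
    using emeasure_bounded_finite[of S] bounded_subset[OF assms(2) that] by (simp add: less_top)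
  have "measure lborel \<Omega> = measure lborel (?A \<union> ?B)"
  proof (rule measure_eq_AE)
    show "AE y in lborel. (y \<in> \<Omega>) = (y \<in> ?A \<union> ?B)"
      using AE_lborel_inner_neq[OF assms(3), of x] by eventually_elim auto
  qed (use sets in auto)
  also have "\<dots> = measure lborel ?A + measure lborel ?B"
    using sets fin by (intro measure_Union) auto
  finally show ?thesis
    by (simp only: measure_half_body[OF assms(1)])
qed

text \<open>The kernel has the sign of \<open>z \<bullet> e\<close>, so its integral splits into
  forward minus backward mass; the dividing line contributes zero.\<close>

lemma riesz_flux_eq_kernel_mass:
  assumes "1 < \<alpha>" "\<alpha> < 3" "norm e = 1" "bounded \<Omega>" and [measurable]: "\<Omega> \<in> sets borel"
  shows "riesz_flux \<alpha> e \<Omega> x = kernel_mass \<alpha> e (half_body \<Omega> x e) - kernel_mass \<alpha> e (half_body \<Omega> x (- e))"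
proof -
  have int: "integrable lborel (\<lambda>z. indicat_real (half_body \<Omega> x v) z * \<bar>grad_kernel \<alpha> e z\<bar>)" for v
    using integrable_kernel_mass[OF assms(1-3) half_body_bounded[OF assms(4)] half_body_borel[OF assms(5)]]
    by (simp add: set_integrable_def)
  have "riesz_flux \<alpha> e \<Omega> x = (\<integral>y. indicator \<Omega> y * grad_kernel \<alpha> e (y - x) \<partial>lborel)"
    by (simp add: riesz_flux_def set_lebesgue_integral_def)
  also have "\<dots> = (\<integral>z. indicator \<Omega> (x + z) * grad_kernel \<alpha> e ((x + z) - x) \<partial>lborel)"
    by (rule integral_lborel_translation[symmetric]) measurable
  also have "\<dots> = (\<integral>z. indicator (half_body \<Omega> x e) z * \<bar>grad_kernel \<alpha> e z\<bar> -
      indicator (half_body \<Omega> x (- e)) z * \<bar>grad_kernel \<alpha> e z\<bar> \<partial>lborel)"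
    by (intro Bochner_Integration.integral_cong)
      (auto simp: half_body_def indicator_def grad_kernel_def abs_mult)
  also have "\<dots> = kernel_mass \<alpha> e (half_body \<Omega> x e) - kernel_mass \<alpha> e (half_body \<Omega> x (- e))"
    using int by (simp add: kernel_mass_def set_lebesgue_integral_def)
  finally show ?thesis .
qed

text \<open>Each point of a convex body is a limit of interior points, so \<open>U\<close> meets the
  interior in a nonempty open set.\<close>

lemma measure_open_Int_convex_pos:
  fixes \<Omega> :: "(real^2) set"
  assumes "compact \<Omega>" "convex \<Omega>" "interior \<Omega> \<noteq> {}" "open U" "x \<in> U" "x \<in> \<Omega>"
  shows "measure lborel (\<Omega> \<inter> U) \<noteq> 0"
proof
  assume 0: "measure lborel (\<Omega> \<inter> U) = 0"
  have "x \<in> closure (interior \<Omega>)"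
    using assms convex_closure_interior[of \<Omega>] closure_subset by blast
  then have ne: "interior \<Omega> \<inter> U \<noteq> {}"
    using assms by (auto simp: closure_iff_nhds_not_empty)
  have "emeasure lborel (\<Omega> \<inter> U) < \<infinity>"
    using assms by (intro emeasure_bounded_finite bounded_subset[OF compact_imp_bounded[OF assms(1)]]) auto
  then have "emeasure lborel (\<Omega> \<inter> U) = 0"
    using 0 by (simp add: emeasure_eq_ennreal_measure less_top[symmetric])
  then have "\<Omega> \<inter> U \<in> null_sets lborel"
    using assms by (intro null_setsI) (auto simp: compact_imp_closed)
  then have "negligible (\<Omega> \<inter> U)"
    by (simp add: negligible_iff_null_sets null_sets_completionI)
  then have "negligible (interior \<Omega> \<inter> U)"
    by (rule negligible_subset) (use interior_subset in auto)
  then show False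
    using open_not_negligible[of "interior \<Omega> \<inter> U"] ne assms(4) by auto
qed

text \<open>Positivity is asked only strictly inside the interval because the sign of the flux is
  unknown at endpoints such as points of the axis.\<close>

lemma set_integral_pos:
  fixes f :: "real \<Rightarrow> real"
  assumes "set_integrable lborel {a..b} f" "a < b" "\<And>s. a < s \<Longrightarrow> s < b \<Longrightarrow> 0 < f s"
  shows "0 < (\<integral>s\<in>{a..b}. f s \<partial>lborel)"
proof -
  have int: "integrable lborel (\<lambda>s. indicat_real {a..b} s * f s)"
    using assms(1) by (simp add: set_integrable_def)
  have nn: "AE s in lborel. 0 \<le> indicat_real {a..b} s * f s"
    using AE_lborel_singleton[of a] AE_lborel_singleton[of b]
  proof eventually_elim
    case (elim s)
    then show ?case
      using assms(3)[of s] by (cases "s \<in> {a..b}") auto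
  qed
  have "(\<integral>s. indicat_real {a..b} s * f s \<partial>lborel) \<noteq> 0"
  proof
    assume "(\<integral>s. indicat_real {a..b} s * f s \<partial>lborel) = 0"
    then have "AE s in lborel. indicat_real {a..b} s * f s = 0"
      using integral_nonneg_eq_0_iff_AE[OF int nn] by simp
    then have "AE s in lborel. s \<notin> {a<..<b}"
    proof eventually_elim
      case (elim s)
      then show ?case
        using assms(3)[of s] by (cases "s \<in> {a<..<b}") auto
    qed
    then have "emeasure lborel {a<..<b} = 0"
      by (subst (asm) AE_iff_measurable[of "{a<..<b}"]) auto
    then show False
      using assms(2) by simp
  qed
  then show ?thesis
    using integral_nonneg_AE[OF nn] by (simp add: set_lebesgue_integral_def)
qed

subsection \<open>Bodies symmetric about a line\<close>

text \<open>An orthonormal frame adapted to the symmetry: \<open>p\<close> lies on the axis,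
  \<open>e\<close> runs along it and \<open>u\<close> is normal to it. The assumptions are invariant
  under replacing \<open>u\<close> by \<open>- u\<close>, which is exploited below.\<close>

locale axisymmetric_body =
  fixes \<Omega> :: "(real^2) set" and p e u :: "real^2" and \<alpha> :: real
  assumes compact: "compact \<Omega>" and convex: "convex \<Omega>" and interior: "interior \<Omega> \<noteq> {}"
    and norm_e: "norm e = 1" and norm_u: "norm u = 1" and orth: "e \<bullet> u = 0"
    and coords: "z = (z \<bullet> e) *\<^sub>R e + (z \<bullet> u) *\<^sub>R u"
    and reflect: "y \<in> \<Omega> \<Longrightarrow> line_reflection p u y \<in> \<Omega>"
    and \<alpha>_gt: "1 < \<alpha>" and \<alpha>_lt: "\<alpha> < 3"
begin

definition pt :: "real \<Rightarrow> real \<Rightarrow> real^2" where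
  "pt a b = p + a *\<^sub>R e + b *\<^sub>R u"

text \<open>The body in frame coordinates, the form to which
  \<open>convex_half_section_scaling\<close> applies.\<close>

definition C :: "(real \<times> real) set" where
  "C = {(a, b). pt a b \<in> \<Omega>}"

lemma ee: "e \<bullet> e = 1" and uu: "u \<bullet> u = 1" and ue: "u \<bullet> e = 0"
  using norm_e norm_u orth by (simp_all add: norm_eq_1 inner_commute)

lemma pt_inner_e: "(pt a b - p) \<bullet> e = a" and pt_inner_u: "(pt a b - p) \<bullet> u = b"
  by (simp_all add: pt_def inner_add_left ee uu ue orth)

lemma pt_coords: "pt ((y - p) \<bullet> e) ((y - p) \<bullet> u) = y"
  unfolding pt_def add.assoc coords[of "y - p", symmetric] by simp

lemma pt_add: "pt a b + z = pt (a + z \<bullet> e) (b + z \<bullet> u)"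
proof -
  have "pt (a + z \<bullet> e) (b + z \<bullet> u) = pt a b + ((z \<bullet> e) *\<^sub>R e + (z \<bullet> u) *\<^sub>R u)"
    by (simp add: pt_def algebra_simps)
  then show ?thesis
    by (simp only: coords[of z, symmetric])
qed

lemma borel: "\<Omega> \<in> sets borel" and bounded: "bounded \<Omega>"
  using compact by (auto simp: compact_imp_closed compact_imp_bounded)

lemma C_sym: "(a, b) \<in> C \<Longrightarrow> (a, - b) \<in> C"
proof -
  have "line_reflection p u (pt a b) = pt a b - (b *\<^sub>R u + b *\<^sub>R u)"
    by (simp only: line_reflection_def pt_inner_u mult_2 scaleR_add_left)
  also have "\<dots> = pt a (- b)"
    by (simp add: pt_def)
  finally have "line_reflection p u (pt a b) = pt a (- b)" .
  then show "(a, b) \<in> C \<Longrightarrow> (a, - b) \<in> C"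
    using reflect[of "pt a b"] by (simp add: C_def)
qed

lemma C_convex: "convex C"
  unfolding convex_alt
proof (intro ballI allI impI)
  fix x y l assume "x \<in> C" "y \<in> C" and l: "0 \<le> l \<and> l \<le> (1::real)"
  then have "(1 - l) *\<^sub>R pt (fst x) (snd x) + l *\<^sub>R pt (fst y) (snd y) \<in> \<Omega>"
    using convexD_alt[OF convex] by (auto simp: C_def)
  moreover have "(1 - l) *\<^sub>R pt (fst x) (snd x) + l *\<^sub>R pt (fst y) (snd y) =
      pt ((1 - l) * fst x + l * fst y) ((1 - l) * snd x + l * snd y)"
    by (simp add: pt_def algebra_simps)
  ultimately show "(1 - l) *\<^sub>R x + l *\<^sub>R y \<in> C"
    by (cases x; cases y) (simp add: C_def)
qed

lemma C_comb:
  assumes "(a, b) \<in> C" "(c, d) \<in> C" "0 \<le> l" "l \<le> 1"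
  shows "((1 - l) * a + l * c, (1 - l) * b + l * d) \<in> C"
  using convexD_alt[OF C_convex assms] by simp

text \<open>The point lies on the segment between \<open>(a, b)\<close> and its mirror image
  \<open>(a, - b)\<close>.\<close>

lemma C_shrink:
  assumes "(a, b) \<in> C" "\<bar>c\<bar> \<le> \<bar>b\<bar>"
  shows "(a, c) \<in> C"
proof (cases "b = 0")
  case False
  define l where "l = (1 + c / b) / 2"
  have "\<bar>c / b\<bar> \<le> 1"
    using assms(2) False by (simp add: abs_divide)
  then have "c / b \<le> 1" "- (c / b) \<le> 1"
    by (rule abs_le_D1, rule abs_le_D2)
  then have "0 \<le> l" "l \<le> 1"
    by (auto simp: l_def)
  then have "((1 - l) * a + l * a, (1 - l) * - b + l * b) \<in> C"
    using assms C_sym by (intro C_comb) auto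
  moreover have "(1 - l) * a + l * a = a" "(1 - l) * - b + l * b = c"
    using False by (simp_all add: l_def field_simps)
  ultimately show ?thesis by simp
qed (use assms in auto)

lemma compact_section: "compact ((\<lambda>y. (y - p) \<bullet> u) ` (\<Omega> \<inter> {y. (y - p) \<bullet> e = t}))"
proof (intro compact_continuous_image compact_Int_closed compact)
  show "closed {y. (y - p) \<bullet> e = t}"
    by (intro closed_Collect_eq continuous_intros)
qed (intro continuous_intros)

text \<open>Both points shrink to the common height \<open>m > 0\<close>, so convexity puts
  \<open>(t, m)\<close> in \<open>C\<close>. The section at \<open>t\<close> is compact, hence has a
  highest point, and that is at least \<open>m\<close>.\<close>

lemma section_top:
  assumes "(a, b) \<in> C" "(a', b') \<in> C" "a \<le> t" "t \<le> a'" "b \<noteq> 0" "b' \<noteq> 0"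
  obtains g where "0 < g" "(t, g) \<in> C" "\<And>h. (t, h) \<in> C \<Longrightarrow> h \<le> g"
proof -
  define m where "m = min \<bar>b\<bar> \<bar>b'\<bar>"
  have "0 < m" using assms by (simp add: m_def)
  have m: "(a, m) \<in> C" "(a', m) \<in> C"
    using assms by (auto intro!: C_shrink[OF assms(1)] C_shrink[OF assms(2)] simp: m_def)
  have tm: "(t, m) \<in> C"
  proof (cases "a = a'")
    case False
    define l where "l = (t - a) / (a' - a)"
    have "0 \<le> l" "l \<le> 1"
      using assms False by (auto simp: l_def divide_le_eq)
    moreover have "(1 - l) * a + l * a' = a + l * (a' - a)"
      by (simp add: algebra_simps)
    then have "(1 - l) * a + l * a' = t"
      using False by (simp add: l_def)
    moreover have "(1 - l) * m + l * m = m"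
      by (simp add: algebra_simps)
    ultimately show ?thesis
      using C_comb[OF m, of l] by simp
  qed (use m assms in auto)
  let ?S = "(\<lambda>y. (y - p) \<bullet> u) ` (\<Omega> \<inter> {y. (y - p) \<bullet> e = t})"
  have S: "h \<in> ?S \<longleftrightarrow> (t, h) \<in> C" for h
  proof
    assume "h \<in> ?S"
    then show "(t, h) \<in> C"
      using pt_coords by (auto simp: C_def)
  next
    assume "(t, h) \<in> C"
    then show "h \<in> ?S"
      by (intro image_eqI[of _ _ "pt t h"]) (auto simp: C_def pt_inner_e pt_inner_u)
  qed
  then obtain g where "g \<in> ?S" "\<forall>h\<in>?S. h \<le> g"
    using compact_attains_sup[OF compact_section[of t]] tm by blast
  then have "(t, g) \<in> C" and top: "\<And>h. (t, h) \<in> C \<Longrightarrow> h \<le> g"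
    using S by blast+
  then show ?thesis
    using that[of g] top[OF tm] \<open>0 < m\<close> by auto
qed

lemma half_body_e: "z \<in> half_body \<Omega> (pt t s) e \<longleftrightarrow> (t + z \<bullet> e, s + z \<bullet> u) \<in> C \<and> 0 < z \<bullet> e"
  and half_body_minus_e: "z \<in> half_body \<Omega> (pt t s) (- e) \<longleftrightarrow> (t + z \<bullet> e, s + z \<bullet> u) \<in> C \<and> z \<bullet> e < 0"
  and half_body_u: "z \<in> half_body \<Omega> (pt t s) u \<longleftrightarrow> (t + z \<bullet> e, s + z \<bullet> u) \<in> C \<and> 0 < z \<bullet> u"
  and half_body_minus_u: "z \<in> half_body \<Omega> (pt t s) (- u) \<longleftrightarrow> (t + z \<bullet> e, s + z \<bullet> u) \<in> C \<and> z \<bullet> u < 0"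
  by (auto simp: half_body_def C_def pt_add)

lemma measure_pos: "measure lborel \<Omega> \<noteq> 0"
  using measure_open_Int_convex_pos[OF compact convex interior open_UNIV, of "SOME y. y \<in> \<Omega>"]
    interior interior_subset by (metis Int_UNIV_right UNIV_I empty_iff equals0I someI_ex subset_empty)

lemma strip_pos:
  assumes "open U" "(a, b) \<in> C" "pt a b \<in> U"
  shows "measure lborel (\<Omega> \<inter> U) \<noteq> 0"
  using measure_open_Int_convex_pos[OF compact convex interior assms(1) assms(3)] assms(2)
  by (simp add: C_def)

text \<open>Source of strictness: enlarging a half body adds a strip disjoint from it, whose area is
  nonzero by \<open>strip_pos\<close>.\<close>

lemma measure_add_strip_le:
  assumes "A \<in> sets borel" "U \<in> sets borel" "B \<in> sets borel" "B \<subseteq> \<Omega>" "A \<subseteq> B" "\<Omega> \<inter> U \<subseteq> B" "A \<inter> U = {}"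
  shows "measure lborel A + measure lborel (\<Omega> \<inter> U) \<le> measure lborel B"
proof -
  have fin: "emeasure lborel S \<noteq> \<infinity>" if "S \<subseteq> \<Omega>" for S
    using emeasure_bounded_finite[of S] bounded_subset[OF bounded that] by (simp add: less_top)
  have "measure lborel A + measure lborel (\<Omega> \<inter> U) = measure lborel (A \<union> (\<Omega> \<inter> U))"
    using assms borel fin by (intro measure_Union[symmetric]) auto
  also have "\<dots> \<le> measure lborel B"
    using assms borel fin[OF assms(4)] by (intro measure_mono_fmeasurable) (auto simp: fmeasurable_def less_top)
  finally show ?thesis .
qed

text \<open>Otherwise the half body would lie in the null line \<open>z \<bullet> u = 0\<close>. The
  point found feeds \<open>section_top\<close>.\<close>

lemma exists_off_axis:
  assumes "measure lborel (half_body \<Omega> x v) \<noteq> 0"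
  obtains z where "z \<in> half_body \<Omega> x v" "z \<bullet> u \<noteq> 0"
proof -
  have "\<exists>z\<in>half_body \<Omega> x v. z \<bullet> u \<noteq> 0"
  proof (rule ccontr)
    assume none: "\<not> ?thesis"
    have "u \<noteq> 0" using norm_u by auto
    then have "AE z in lborel. (z \<in> half_body \<Omega> x v) = (z \<in> {})"
      using AE_lborel_inner_neq[of u 0] none by (auto elim!: eventually_mono)
    then have "measure lborel (half_body \<Omega> x v) = measure lborel ({} :: (real^2) set)"
      using half_body_borel[OF borel] by (intro measure_eq_AE) auto
    then show False using assms by simp
  qed
  then show ?thesis using that by blast
qed

section \<open>Comparison of half bodies along the axis\<close>

lemma half_body_scaling:
  assumes "t < t'" "0 < g" "0 < g'" "(t, g) \<in> C" "(t', g') \<in> C"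
    and top: "\<And>h. (t, h) \<in> C \<Longrightarrow> h \<le> g" and top': "\<And>h. (t', h) \<in> C \<Longrightarrow> h \<le> g'"
  shows "half_body \<Omega> (pt t' 0) e \<subseteq> (*\<^sub>R) (g' / g) ` half_body \<Omega> (pt t 0) e"
    and "(*\<^sub>R) (g' / g) ` half_body \<Omega> (pt t 0) (- e) \<subseteq> half_body \<Omega> (pt t' 0) (- e)"
proof
  fix z assume "z \<in> half_body \<Omega> (pt t' 0) e"
  then have "(t' + z \<bullet> e, z \<bullet> u) \<in> C" "0 < z \<bullet> e"
    by (auto simp: half_body_e)
  then have "(t + (z \<bullet> e) * (g / g'), (z \<bullet> u) * (g / g')) \<in> C"
    using convex_half_section_scaling[OF C_convex C_sym assms(1-4) top', of "z \<bullet> e"] by auto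
  then have "(g / g') *\<^sub>R z \<in> half_body \<Omega> (pt t 0) e"
    using \<open>0 < z \<bullet> e\<close> assms by (auto simp: half_body_e mult_ac)
  then show "z \<in> (*\<^sub>R) (g' / g) ` half_body \<Omega> (pt t 0) e"
    using assms by (intro image_eqI[of _ _ "(g / g') *\<^sub>R z"]) auto
next
  \<comment> \<open>For the backward parts the axis is reversed: then \<open>- t' < - t\<close>, and
    \<open>g\<close> and \<open>g'\<close> exchange roles.\<close>
  let ?C = "(\<lambda>(a, b). (- a, b)) -` C"
  have C': "convex ?C"
    by (intro convex_linear_vimage C_convex linearI) auto
  show "(*\<^sub>R) (g' / g) ` half_body \<Omega> (pt t 0) (- e) \<subseteq> half_body \<Omega> (pt t' 0) (- e)"
  proof
    fix w assume "w \<in> (*\<^sub>R) (g' / g) ` half_body \<Omega> (pt t 0) (- e)"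
    then obtain z where z: "z \<in> half_body \<Omega> (pt t 0) (- e)" and w: "w = (g' / g) *\<^sub>R z"
      by blast
    then have "(- t + - (z \<bullet> e), z \<bullet> u) \<in> ?C" "z \<bullet> e < 0"
      by (auto simp: half_body_minus_e add.commute)
    then have "(- t' + - (z \<bullet> e) * (g' / g), (z \<bullet> u) * (g' / g)) \<in> ?C"
      using convex_half_section_scaling[OF C', of "- t'" "- t" g' g "- (z \<bullet> e)" "z \<bullet> u"] C_sym assms by auto
    then show "w \<in> half_body \<Omega> (pt t' 0) (- e)"
      using \<open>z \<bullet> e < 0\<close> assms by (auto simp: half_body_minus_e w mult_ac add.commute mult_less_0_iff divide_neg_pos)
  qed
qed

text \<open>The open strip between the abscissas contains the midpoint of the two given points, so
  it carries positive area.\<close>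

lemma measure_half_body_strict_antimono:
  assumes "t < t'" "(t, g) \<in> C" "(t', g') \<in> C"
  shows "measure lborel (half_body \<Omega> (pt t' 0) e) < measure lborel (half_body \<Omega> (pt t 0) e)"
proof -
  have [measurable]: "\<Omega> \<in> sets borel" by (rule borel)
  let ?U = "{y. t < (y - p) \<bullet> e} \<inter> {y. (y - p) \<bullet> e < t'}"
  have in_e: "(y - pt s 0) \<bullet> e = (y - p) \<bullet> e - s" for y s
    by (simp add: pt_def inner_diff_left inner_add_left ee)
  have U: "open ?U"
    by (intro open_Int open_Collect_less continuous_intros)
  have "((1 - 1/2) * t + 1/2 * t', (1 - 1/2) * g + 1/2 * g') \<in> C"
    using assms by (intro C_comb) auto
  then have pos: "measure lborel (\<Omega> \<inter> ?U) \<noteq> 0"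
    using assms(1) by (intro strip_pos[OF U]) (auto simp: pt_inner_e)
  have "measure lborel {y \<in> \<Omega>. 0 < (y - pt t' 0) \<bullet> e} + measure lborel (\<Omega> \<inter> ?U) \<le>
      measure lborel {y \<in> \<Omega>. 0 < (y - pt t 0) \<bullet> e}"
  proof (rule measure_add_strip_le)
    show "{y \<in> \<Omega>. 0 < (y - pt t' 0) \<bullet> e} \<in> sets borel" "{y \<in> \<Omega>. 0 < (y - pt t 0) \<bullet> e} \<in> sets borel"
      by measurable
    show "?U \<in> sets borel" using U by (rule borel_open)
  qed (use assms(1) in \<open>auto simp: in_e\<close>)
  then show ?thesis
    unfolding measure_half_body[OF borel]
    using pos measure_nonneg[of lborel "\<Omega> \<inter> ?U"] by linarith
qed

lemmas flux_split = riesz_flux_eq_kernel_mass[OF \<alpha>_gt \<alpha>_lt _ bounded borel]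

text \<open>Write \<open>A\<close>, \<open>B\<close> for the forward and backward parts and
  \<open>K\<close> for mass. Then
  \<open>K (A t') \<le> K (k A t) \<le> K (k B t) \<le> K (B t')\<close>: the outer steps are the
  inclusions of \<open>half_body_scaling\<close>, the middle one is the assumption at
  \<open>t\<close> after dilation. Equality throughout is excluded by comparing areas.\<close>

lemma flux_sign_change:
  assumes "t < t'" and le: "riesz_flux \<alpha> e \<Omega> (pt t 0) \<le> 0"
  shows "riesz_flux \<alpha> e \<Omega> (pt t' 0) < 0"
proof -
  let ?A = "\<lambda>t. half_body \<Omega> (pt t 0) e" and ?B = "\<lambda>t. half_body \<Omega> (pt t 0) (- e)"
  let ?K = "kernel_mass \<alpha> e" and ?m = "measure lborel"
  have flux: "riesz_flux \<alpha> e \<Omega> (pt t 0) = ?K (?A t) - ?K (?B t)" for t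
    by (rule flux_split[OF norm_e])
  have hb: "half_body \<Omega> x v \<in> sets borel" "bounded (half_body \<Omega> x v)" for x v
    by (simp_all add: half_body_borel half_body_bounded borel bounded)
  have "e \<noteq> 0" using norm_e by auto
  have add: "?m \<Omega> = ?m (?A t) + ?m (?B t)" for t
    by (rule measure_half_body_add[OF borel bounded \<open>e \<noteq> 0\<close>])
  note K_pos = kernel_mass_pos[OF \<alpha>_gt \<alpha>_lt norm_e hb(2) hb(1)]
  note K_null = kernel_mass_null[OF hb]
  show ?thesis
  \<comment> \<open>A null backward part at \<open>t\<close> would make the flux there positive; a
    null forward part at \<open>t'\<close> makes the flux there negative at once. Otherwise off-axis
    points behind \<open>t\<close> and ahead of \<open>t'\<close> guarantee positive half-widths at
    both places.\<close>
  proof (cases "?m (?B t) = 0 \<or> ?m (?A t') = 0")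
    case True
    then show ?thesis
    proof
      assume "?m (?B t) = 0"
      then have "?K (?B t) = 0" "0 < ?K (?A t)"
        using K_null K_pos add[of t] measure_pos by auto
      then show ?thesis using le flux by simp
    next
      assume "?m (?A t') = 0"
      then have "?K (?A t') = 0" "0 < ?K (?B t')"
        using K_null K_pos add[of t'] measure_pos by auto
      then show ?thesis using flux by simp
    qed
  next
    case False
    obtain z where "z \<in> ?B t" "z \<bullet> u \<noteq> 0"
      using exists_off_axis False by blast
    then have left: "(t + z \<bullet> e, z \<bullet> u) \<in> C" "t + z \<bullet> e \<le> t" "z \<bullet> u \<noteq> 0"
      by (auto simp: half_body_minus_e)
    obtain z' where "z' \<in> ?A t'" "z' \<bullet> u \<noteq> 0"
      using exists_off_axis False by blast
    then have right: "(t' + z' \<bullet> e, z' \<bullet> u) \<in> C" "t' \<le> t' + z' \<bullet> e" "z' \<bullet> u \<noteq> 0"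
      by (auto simp: half_body_e)
    obtain g where g: "0 < g" "(t, g) \<in> C" "\<And>h. (t, h) \<in> C \<Longrightarrow> h \<le> g"
      using section_top[OF left(1) right(1), of t] left right assms(1) by auto
    obtain g' where g': "0 < g'" "(t', g') \<in> C" "\<And>h. (t', h) \<in> C \<Longrightarrow> h \<le> g'"
      using section_top[OF left(1) right(1), of t'] left right assms(1) by auto
    define k where "k = g' / g"
    have "0 < k" using g g' by (simp add: k_def)
    let ?kA = "(*\<^sub>R) k ` ?A t" and ?kB = "(*\<^sub>R) k ` ?B t"
    have sub: "?A t' \<subseteq> ?kA" "?kB \<subseteq> ?B t'"
      unfolding k_def by (rule half_body_scaling[OF assms(1) g(1) g'(1) g(2) g'(2) g(3) g'(3)]; assumption)+
    have k_sets: "?kA \<in> sets borel" "?kB \<in> sets borel" "bounded ?kA"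
      using hb \<open>0 < k\<close> by (simp_all add: sets_borel_scaleR_image bounded_scaling)
    note mono = kernel_mass_mono[OF \<alpha>_gt \<alpha>_lt norm_e]
    note eq = kernel_mass_eq_imp[OF \<alpha>_gt \<alpha>_lt norm_e]
    have KA: "?K (?A t') \<le> ?K ?kA" and KB: "?K ?kB \<le> ?K (?B t')"
      using mono[OF k_sets(3) hb(1) k_sets(1) sub(1)] mono[OF hb(2) k_sets(2) hb(1) sub(2)] by auto
    have AB: "?K ?kA \<le> ?K ?kB"
      using le \<open>0 < k\<close> by (simp add: flux kernel_mass_scaleR_image hb)
    show ?thesis
    proof (rule ccontr)
      assume "\<not> ?thesis"
      \<comment> \<open>A nonnegative flux at \<open>t'\<close> closes the chain, so all its masses
        agree and each inclusion is an equality of areas.\<close>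
      then have BA: "?K (?B t') \<le> ?K (?A t')"
        by (simp add: flux)
      have "?m (?A t') = ?m ?kA"
        using eq[OF k_sets(3) hb(1) k_sets(1) sub(1)] KA KB AB BA by linarith
      moreover have "?m ?kB = ?m (?B t')"
        using eq[OF hb(2) k_sets(2) hb(1) sub(2)] KA KB AB BA by linarith
      ultimately have mA: "?m (?A t') = k^2 * ?m (?A t)" and mB: "?m (?B t') = k^2 * ?m (?B t)"
        using \<open>0 < k\<close> by (simp_all add: measure_lborel_scaleR_image hb)
      \<comment> \<open>Forward and backward areas add up to the area of \<Omega> at
        \<open>t\<close> and at \<open>t'\<close>, which forces \<open>k^2 = 1\<close>.\<close>
      have "?m \<Omega> = k^2 * ?m \<Omega>"
        using add[of t] add[of t'] mA mB by (simp add: distrib_left)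
      then have "k^2 = 1"
        using measure_pos by simp
      then have "?m (?A t') = ?m (?A t)"
        using mA by simp
      then show False
        using measure_half_body_strict_antimono[OF assms(1) g(2) g'(2)] by simp
    qed
  qed
qed

end

section \<open>Comparison across the axis\<close>

lemma orthogonal_transformation_line_reflection:
  assumes "norm u = 1"
  shows "orthogonal_transformation (line_reflection 0 u)"
proof -
  have uu: "u \<bullet> u = 1" using assms by (simp add: norm_eq_1)
  have "linear (line_reflection 0 u)"
    by (rule linearI) (simp_all add: line_reflection_def inner_add_left algebra_simps)
  moreover have "line_reflection 0 u v \<bullet> line_reflection 0 u w = v \<bullet> w" for v w
    by (simp add: line_reflection_def inner_diff_left inner_diff_right uu inner_commute[of u w])
  ultimately show ?thesis
    by (simp add: orthogonal_transformation_def)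
qed

text \<open>Reflection preserves area and norm and only flips the sign of
  \<open>z \<bullet> u\<close>, which the absolute value hides.\<close>

lemma kernel_mass_line_reflection_vimage:
  assumes "norm u = 1" and [measurable]: "S \<in> sets borel"
  shows "kernel_mass \<alpha> u (line_reflection 0 u -` S) = kernel_mass \<alpha> u S"
proof -
  let ?T = "line_reflection 0 u"
  have T: "orthogonal_transformation ?T"
    using assms(1) by (rule orthogonal_transformation_line_reflection)
  have [measurable]: "?T \<in> borel_measurable borel"
    unfolding line_reflection_def by measurable
  have uu: "u \<bullet> u = 1" using assms(1) by (simp add: norm_eq_1)
  have "\<bar>grad_kernel \<alpha> u (?T z)\<bar> = \<bar>grad_kernel \<alpha> u z\<bar>" for z
    using orthogonal_transformation_norm[OF T, of z]
    by (simp add: grad_kernel_def abs_mult) (simp add: line_reflection_def inner_diff_left uu)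
  then have "kernel_mass \<alpha> u (?T -` S) = (\<integral>z. indicator S (?T z) * \<bar>grad_kernel \<alpha> u (?T z)\<bar> \<partial>lborel)"
    by (simp add: kernel_mass_def set_lebesgue_integral_def indicator_vimage)
  also have "\<dots> = (\<integral>z. indicator S z * \<bar>grad_kernel \<alpha> u z\<bar> \<partial>distr lborel borel ?T)"
    by (subst integral_distr) auto
  finally show ?thesis
    by (simp add: lborel_distr_orthogonal_transformation[OF T] kernel_mass_def set_lebesgue_integral_def)
qed

context axisymmetric_body
begin

lemma axis_point: obtains a where "(a, 0) \<in> C"
proof -
  obtain y where "y \<in> \<Omega>"
    using interior interior_subset by blast
  then have "((y - p) \<bullet> e, (y - p) \<bullet> u) \<in> C"
    by (simp add: C_def pt_coords)
  then have "((y - p) \<bullet> e, 0) \<in> C"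
    by (rule C_shrink) simp
  then show ?thesis
    by (rule that)
qed

text \<open>Mirroring the outer part gives the part beyond the mirror point in direction
  \<open>- u\<close>. \<open>C_shrink\<close> places it inside the inner part, and the strip between
  the two viewpoints makes the inequality strict.\<close>

lemma flux_off_axis:
  assumes "0 < s"
  shows "riesz_flux \<alpha> u \<Omega> (pt t s) < 0"
proof -
  have [measurable]: "\<Omega> \<in> sets borel" by (rule borel)
  let ?T = "line_reflection 0 u"
  let ?A = "half_body \<Omega> (pt t s) u" and ?B = "half_body \<Omega> (pt t s) (- u)"
    and ?A' = "half_body \<Omega> (pt t (- s)) (- u)"
  let ?K = "kernel_mass \<alpha> u" and ?m = "measure lborel"
  have hb: "half_body \<Omega> x v \<in> sets borel" "bounded (half_body \<Omega> x v)" for x v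
    by (simp_all add: half_body_borel half_body_bounded borel bounded)
  have T: "?T z \<bullet> e = z \<bullet> e" "?T z \<bullet> u = - (z \<bullet> u)" for z
    by (simp_all add: line_reflection_def inner_diff_left uu ue)
  have "(a, s - b) \<in> C \<longleftrightarrow> (a, b - s) \<in> C" for a b
    using C_sym[of a "s - b"] C_sym[of a "b - s"] by auto
  then have A': "?T -` ?A = ?A'"
    by (auto simp: half_body_u half_body_minus_u T)
  have sub: "?A' \<subseteq> ?B"
  proof
    fix z assume "z \<in> ?A'"
    then have z: "(t + z \<bullet> e, - s + z \<bullet> u) \<in> C" "z \<bullet> u < 0"
      by (auto simp: half_body_minus_u)
    \<comment> \<open>As \<open>z \<bullet> u < 0 < s\<close>, moving the viewpoint from
      \<open>- s\<close> to \<open>s\<close> does not increase the distance to the axis.\<close>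
    then have "(t + z \<bullet> e, s + z \<bullet> u) \<in> C"
      using assms by (intro C_shrink[OF z(1)]) auto
    then show "z \<in> ?B"
      using z by (simp add: half_body_minus_u)
  qed
  have "?K ?A < ?K ?B"
  proof (rule ccontr)
    assume "\<not> ?thesis"
    then have "?K ?B \<le> ?K ?A'"
      using kernel_mass_line_reflection_vimage[OF norm_u hb(1), of \<alpha> "pt t s" u] by (simp add: A')
    then have eq: "?m ?A' = ?m ?B"
      by (rule kernel_mass_eq_imp[OF \<alpha>_gt \<alpha>_lt norm_u hb(2) hb(1) hb(1) sub])
    let ?U = "{y. - s < (y - p) \<bullet> u} \<inter> {y. (y - p) \<bullet> u < s}"
    have U: "open ?U"
      by (intro open_Int open_Collect_less continuous_intros)
    obtain a where "(a, 0) \<in> C" by (rule axis_point)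
    then have pos: "?m (\<Omega> \<inter> ?U) \<noteq> 0"
      using assms by (intro strip_pos[OF U]) (auto simp: pt_inner_u)
    have in_u: "(y - pt t r) \<bullet> (- u) = r - (y - p) \<bullet> u" for y r
      by (simp add: pt_def inner_diff_left inner_add_left uu orth)
    have "?m {y \<in> \<Omega>. 0 < (y - pt t (- s)) \<bullet> (- u)} + ?m (\<Omega> \<inter> ?U) \<le> ?m {y \<in> \<Omega>. 0 < (y - pt t s) \<bullet> (- u)}"
    proof (rule measure_add_strip_le)
      show "{y \<in> \<Omega>. 0 < (y - pt t (- s)) \<bullet> (- u)} \<in> sets borel"
        "{y \<in> \<Omega>. 0 < (y - pt t s) \<bullet> (- u)} \<in> sets borel"
        by measurable
      show "?U \<in> sets borel" using U by (rule borel_open)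
    qed (use assms in \<open>auto simp: in_u simp del: inner_minus_right\<close>)
    then have "?m ?A' + ?m (\<Omega> \<inter> ?U) \<le> ?m ?B"
      by (simp only: measure_half_body[OF borel])
    then show False
      using eq pos measure_nonneg[of lborel "\<Omega> \<inter> ?U"] by linarith
  qed
  then show ?thesis
    by (simp add: flux_split[OF norm_u])
qed

section \<open>Maxima of the integral\<close>

lemma riesz_integral_off_axis_pos:
  assumes "0 < w"
  shows "riesz_integral \<alpha> \<Omega> (pt t w) < riesz_integral \<alpha> \<Omega> (pt t 0)"
proof -
  have pt: "pt t 0 + s *\<^sub>R u = pt t s" for s
    by (simp add: pt_def)
  have w: "0 \<le> w" using assms by simp
  note diff = riesz_integral_diff[OF \<alpha>_gt \<alpha>_lt compact norm_u w, of "pt t 0", unfolded pt]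
  have "0 < (\<integral>s\<in>{0..w}. - riesz_flux \<alpha> u \<Omega> (pt t s) \<partial>lborel)"
    using diff(1) assms flux_off_axis
    by (intro set_integral_pos) (auto simp: set_integrable_def)
  then show ?thesis
    using diff(2) by (simp add: set_lebesgue_integral_def)
qed

lemma riesz_integral_off_axis:
  assumes "w \<noteq> 0"
  shows "riesz_integral \<alpha> \<Omega> (pt t w) < riesz_integral \<alpha> \<Omega> (pt t 0)"
proof (cases "0 < w")
  case False
  \<comment> \<open>For \<open>w < 0\<close>, flipping the normal turns \<open>w\<close> into
    \<open>- w > 0\<close>.\<close>
  interpret neg: axisymmetric_body \<Omega> p e "- u" \<alpha>
  proof
    show "z = (z \<bullet> e) *\<^sub>R e + (z \<bullet> - u) *\<^sub>R - u" for z
      using coords by simp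
    show "y \<in> \<Omega> \<Longrightarrow> line_reflection p (- u) y \<in> \<Omega>" for y
      using reflect by (simp add: line_reflection_def)
  qed (simp_all add: compact convex interior norm_e norm_u orth \<alpha>_gt \<alpha>_lt)
  have "neg.pt a b = pt a (- b)" for a b
    by (simp add: neg.pt_def pt_def)
  then show ?thesis
    using neg.riesz_integral_off_axis_pos[of "- w" t] False assms by simp
qed (rule riesz_integral_off_axis_pos)

lemma flux_left:
  assumes "\<And>a b. (a, b) \<in> C \<Longrightarrow> t \<le> a"
  shows "0 < riesz_flux \<alpha> e \<Omega> (pt t 0)"
proof -
  have empty: "half_body \<Omega> (pt t 0) (- e) = {}"
    using assms by (fastforce simp: half_body_minus_e)
  have "e \<noteq> 0" using norm_e by auto
  then have "measure lborel (half_body \<Omega> (pt t 0) e) \<noteq> 0"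
    using measure_half_body_add[OF borel bounded, of e "pt t 0"] measure_pos empty by simp
  then have "0 < kernel_mass \<alpha> e (half_body \<Omega> (pt t 0) e)"
    by (rule kernel_mass_pos[OF \<alpha>_gt \<alpha>_lt norm_e half_body_bounded[OF bounded] half_body_borel[OF borel]])
  then show ?thesis
    by (simp add: flux_split[OF norm_e] empty kernel_mass_null[of "{}"])
qed

lemma flux_right:
  assumes "\<And>a b. (a, b) \<in> C \<Longrightarrow> a \<le> t"
  shows "riesz_flux \<alpha> e \<Omega> (pt t 0) < 0"
proof -
  have empty: "half_body \<Omega> (pt t 0) e = {}"
    using assms by (fastforce simp: half_body_e)
  have "e \<noteq> 0" using norm_e by auto
  then have "measure lborel (half_body \<Omega> (pt t 0) (- e)) \<noteq> 0"
    using measure_half_body_add[OF borel bounded, of e "pt t 0"] measure_pos empty by simp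
  then have "0 < kernel_mass \<alpha> e (half_body \<Omega> (pt t 0) (- e))"
    by (rule kernel_mass_pos[OF \<alpha>_gt \<alpha>_lt norm_e half_body_bounded[OF bounded] half_body_borel[OF borel]])
  then show ?thesis
    by (simp add: flux_split[OF norm_e] empty kernel_mass_null[of "{}"])
qed

lemma riesz_integral_axis_less:
  assumes "a < b" "\<And>s. a < s \<Longrightarrow> s < b \<Longrightarrow> 0 < riesz_flux \<alpha> e \<Omega> (pt s 0)"
  shows "riesz_integral \<alpha> \<Omega> (pt a 0) < riesz_integral \<alpha> \<Omega> (pt b 0)"
proof -
  have pt: "p + s *\<^sub>R e = pt s 0" for s
    by (simp add: pt_def)
  have ab: "a \<le> b" using assms by simp
  note diff = riesz_integral_diff[OF \<alpha>_gt \<alpha>_lt compact norm_e ab, of p, unfolded pt]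
  show ?thesis
    using set_integral_pos[OF diff(1) assms] diff(2) by simp
qed

lemma riesz_integral_axis_greater:
  assumes "a < b" "\<And>s. a < s \<Longrightarrow> s < b \<Longrightarrow> riesz_flux \<alpha> e \<Omega> (pt s 0) < 0"
  shows "riesz_integral \<alpha> \<Omega> (pt b 0) < riesz_integral \<alpha> \<Omega> (pt a 0)"
proof -
  have pt: "p + s *\<^sub>R e = pt s 0" for s
    by (simp add: pt_def)
  have ab: "a \<le> b" using assms by simp
  note diff = riesz_integral_diff[OF \<alpha>_gt \<alpha>_lt compact norm_e ab, of p, unfolded pt]
  have "0 < (\<integral>s\<in>{a..b}. - riesz_flux \<alpha> e \<Omega> (pt s 0) \<partial>lborel)"
    using diff(1) assms by (intro set_integral_pos) (auto simp: set_integrable_def)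
  then show ?thesis
    using diff(2) by (simp add: set_lebesgue_integral_def)
qed

text \<open>If the flux is nonpositive at some \<open>s\<close> between, it is negative from there
  on and \<open>s\<close> beats \<open>t'\<close>. Otherwise it is positive throughout and
  \<open>t'\<close> beats \<open>t\<close>.\<close>

lemma not_both_maximal_on_axis:
  assumes "t < t'"
  shows "\<exists>s. riesz_integral \<alpha> \<Omega> (pt t 0) < riesz_integral \<alpha> \<Omega> (pt s 0) \<or>
    riesz_integral \<alpha> \<Omega> (pt t' 0) < riesz_integral \<alpha> \<Omega> (pt s 0)"
proof (cases "\<exists>s. t < s \<and> s < t' \<and> riesz_flux \<alpha> e \<Omega> (pt s 0) \<le> 0")
  case True
  then obtain s where s: "t < s" "s < t'" "riesz_flux \<alpha> e \<Omega> (pt s 0) \<le> 0"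
    by blast
  then have "riesz_integral \<alpha> \<Omega> (pt t' 0) < riesz_integral \<alpha> \<Omega> (pt s 0)"
    using flux_sign_change by (intro riesz_integral_axis_greater) auto
  then show ?thesis by blast
next
  case False
  then have "riesz_integral \<alpha> \<Omega> (pt t 0) < riesz_integral \<alpha> \<Omega> (pt t' 0)"
    using assms by (intro riesz_integral_axis_less) force+
  then show ?thesis by auto
qed

text \<open>Beyond the extent of the body the flux points back towards it, so a maximum over a
  compact interval of the axis is a maximum over the whole axis.\<close>

lemma axis_maximum: "\<exists>t. \<forall>s. riesz_integral \<alpha> \<Omega> (pt s 0) \<le> riesz_integral \<alpha> \<Omega> (pt t 0)"
proof -
  obtain M where M: "0 < M" "\<Omega> \<subseteq> ball p M"
    using bounded_subset_ballD[OF bounded] by blast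
  have C_bound: "\<bar>a\<bar> \<le> M" if "(a, b) \<in> C" for a b
  proof -
    have "\<bar>a\<bar> = \<bar>(pt a b - p) \<bullet> e\<bar>"
      by (simp add: pt_inner_e)
    also have "\<dots> \<le> norm (pt a b - p)"
      using Cauchy_Schwarz_ineq2[of "pt a b - p" e] norm_e by simp
    also have "\<dots> \<le> M"
      using that M by (auto simp: C_def dist_norm norm_minus_commute subset_eq less_imp_le)
    finally show ?thesis .
  qed
  let ?f = "\<lambda>s. riesz_integral \<alpha> \<Omega> (pt s 0)"
  have "continuous_on {- M..M} ?f"
    using continuous_on_riesz_integral_line[OF \<alpha>_gt \<alpha>_lt norm_e compact, of "- M" M p] by (simp add: pt_def)
  then obtain t where t: "t \<in> {- M..M}" "\<And>s. s \<in> {- M..M} \<Longrightarrow> ?f s \<le> ?f t"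
    using continuous_attains_sup[of "{- M..M}" ?f] M(1) by auto
  have "?f s \<le> ?f t" for s
  proof -
    consider "s < - M" | "s \<in> {- M..M}" | "M < s"
      by fastforce
    then show ?thesis
    proof cases
      case 1
      have "?f s < ?f (- M)"
        using 1 C_bound by (intro riesz_integral_axis_less flux_left) (auto, smt (verit))
      also have "\<dots> \<le> ?f t"
        using M(1) by (intro t) auto
      finally show ?thesis by simp
    next
      case 3
      have "?f s < ?f M"
        using 3 C_bound by (intro riesz_integral_axis_greater flux_right) (auto, smt (verit))
      also have "\<dots> \<le> ?f t"
        using M(1) by (intro t) auto
      finally show ?thesis by simp
    qed (rule t)
  qed
  then show ?thesis by blast
qed

text \<open>Projection to the axis never lowers the integral and raises it strictly off the axis, so
  both existence and uniqueness reduce to the axis.\<close>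

lemma unique_maximum: "\<exists>!x. \<forall>z. riesz_integral \<alpha> \<Omega> z \<le> riesz_integral \<alpha> \<Omega> x"
proof -
  let ?W = "riesz_integral \<alpha> \<Omega>"
  obtain t where t: "\<And>s. ?W (pt s 0) \<le> ?W (pt t 0)"
    using axis_maximum by blast
  have "?W z \<le> ?W (pt t 0)" for z
  proof -
    have "?W z \<le> ?W (pt ((z - p) \<bullet> e) 0)"
      using riesz_integral_off_axis[of "(z - p) \<bullet> u" "(z - p) \<bullet> e"]
      by (cases "(z - p) \<bullet> u = 0") (metis order_refl pt_coords, simp add: pt_coords)
    then show ?thesis
      using t order_trans by blast
  qed
  moreover have "x = pt t 0" if x: "\<And>z. ?W z \<le> ?W x" for x
  proof -
    define s where "s = (x - p) \<bullet> e"
    have "(x - p) \<bullet> u = 0"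
      using riesz_integral_off_axis[of "(x - p) \<bullet> u" s] x[of "pt s 0"] by (auto simp: s_def pt_coords)
    then have xs: "x = pt s 0"
      using pt_coords[of x] by (simp add: s_def)
    have "s = t"
      using not_both_maximal_on_axis[of s t] not_both_maximal_on_axis[of t s] t x unfolding xs
      by (metis linorder_neqE_linordered_idom not_less)
    then show ?thesis using xs by simp
  qed
  ultimately show ?thesis by blast
qed

end

subsection \<open>Riesz centers\<close>

lemma riesz_potential_eq:
  "riesz_potential \<alpha> \<Omega> x = (if \<alpha> = 2 then 1 else 2 - \<alpha>) * riesz_integral \<alpha> \<Omega> x"
  by (simp add: riesz_potential_def riesz_integral_def riesz_kernel_def set_lebesgue_integral_def)

text \<open>The factor in \<open>riesz_potential_eq\<close> is positive for
  \<open>\<alpha> \<le> 2\<close> and negative for \<open>\<alpha> > 2\<close>, matching the switch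
  from maximum to minimum.\<close>

lemma is_riesz_center_iff:
  "is_riesz_center \<alpha> \<Omega> x \<longleftrightarrow> (\<forall>z. riesz_integral \<alpha> \<Omega> z \<le> riesz_integral \<alpha> \<Omega> x)"
  by (cases \<alpha> "2 :: real" rule: linorder_cases)
    (auto simp: is_riesz_center_def riesz_potential_eq mult_le_cancel_left)

theorem theorem5p3:
  fixes \<Omega> :: "(real^2) set" and \<alpha> :: real
  assumes "convex_body \<Omega>"
    and "piecewise_C1_boundary \<Omega>"
    and "axially_symmetric \<Omega>"
    and "1 < \<alpha>" and "\<alpha> < 3"
  shows "\<exists>!x. is_riesz_center \<alpha> \<Omega> x"
proof -
  obtain p u where u: "norm u = 1" and image: "line_reflection p u ` \<Omega> = \<Omega>"
    using assms(3) unfolding axially_symmetric_def by blast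
  \<comment> \<open>A quarter turn of the unit normal \<open>u\<close>, hence a unit direction of
    the axis.\<close>
  define e :: "real^2" where "e = vector [u $ 2, - (u $ 1)]"
  have uu: "u $ 1 * u $ 1 + u $ 2 * u $ 2 = 1"
    using u by (simp add: norm_eq_1 inner_vec_def sum_2)
  interpret axisymmetric_body \<Omega> p e u \<alpha>
  proof
    show "norm e = 1"
      using uu by (simp add: norm_eq_1 inner_vec_def sum_2 e_def add.commute)
    show "e \<bullet> u = 0"
      by (simp add: inner_vec_def sum_2 e_def mult.commute)
    show "z = (z \<bullet> e) *\<^sub>R e + (z \<bullet> u) *\<^sub>R u" for z
    proof -
      \<comment> \<open>The two coordinates of the frame expansion of \<open>z\<close>; by
        \<open>uu\<close> they reduce to those of \<open>z\<close>.\<close>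
      have "(z $ 1 * u $ 2 - z $ 2 * u $ 1) * u $ 2 + (z $ 1 * u $ 1 + z $ 2 * u $ 2) * u $ 1 =
          z $ 1 * (u $ 1 * u $ 1 + u $ 2 * u $ 2)"
        "(z $ 1 * u $ 2 - z $ 2 * u $ 1) * - u $ 1 + (z $ 1 * u $ 1 + z $ 2 * u $ 2) * u $ 2 =
          z $ 2 * (u $ 1 * u $ 1 + u $ 2 * u $ 2)"
        by (simp_all add: algebra_simps)
      then show ?thesis
        by (simp add: uu vec_eq_iff forall_2 inner_vec_def sum_2 e_def)
    qed
    show "y \<in> \<Omega> \<Longrightarrow> line_reflection p u y \<in> \<Omega>" for y
      using image by blast
  qed (use assms u in \<open>auto simp: convex_body_def\<close>)
  show ?thesis
    unfolding is_riesz_center_iff by (rule unique_maximum)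
qed

end
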